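(* Assume $\diamondsuit$. Let $\mathcal A=\langle a_\alpha:\alpha<\omega_1\rangle$ be a proper coherent sequence of subsets of $\omega$ that has the ScP. Then there is a (free) ultrafilter $\mathcal D$ on $\omega$ such that forcing with $\mathbb L(\mathcal D)$ preserves that $\mathcal A$ has the ScP (i.e. $\mathcal A$ has the ScP in every generic extension by $\mathbb L(\mathcal D)$).
   Context: A sequence $\langle a_\alpha:\alpha<\lambda\rangle$ of subsets of $\omega$ is coherent if for all $\alpha\le\beta<\lambda$ there is a finite $F\subseteq\alpha$ with $a_\alpha\cap a_\beta\subseteq a_F$ or $a_\alpha\subseteq a_\beta\cup a_F$, where $a_F=\bigcup_{\gamma\in F}a_\gamma$ ($a_\emptyset=\emptyset$); it is proper if no $a_\beta$ is contained in a finite union of sets $a_\xi$, $\xi<\beta$. For $\beta<\lambda$, $\widehat a_\beta$ is the set of $\alpha\le\beta$ such that $a_\alpha\setminus a_\beta\subseteq a_F$ for some finite $F\subseteq\alpha$; for finite $F$, $\widehat a_F=\bigcup_{\alpha\in F}\widehat a_\alpha$. For a sequence of length $\omega_1$, a set $S\subseteq\omega_1$ is a cover if $\bigcup_{\gamma\in S}\widehat a_\gamma=\omega_1$; the sequence has the ScP (stationary covering property) if for every stationary $S\subseteq\omega_1$ there is a finite $F\subseteq\omega_1$ with $S\cup F$ a cover. For a filter $\mathcal D$ on $\omega$, $\mathbb L(\mathcal D)$ is the set of trees $T\subseteq\omega^{<\omega}$ closed under initial segments, with stem $\mathrm{stem}(T)$ the minimal node having more than one immediate successor in $T$, such that for every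 $t\in T$ with $\mathrm{stem}(T)\subseteq t$, $\{j: t^\frown j\in T\}\in\mathcal D$; it is ordered by inclusion. *)

theory Defs
  imports "HOL-Library.Countable_Set_Type" "HOL-Library.Sublist"
begin

unbundle cardinal_syntax

section \<open>The ordinal \<open>\<omega>\<^sub>1\<close> as a well-ordered type\<close>

typedef omega1 = "Field (cardSuc natLeq)"
proof -
  have "Field (cardSuc natLeq) \<noteq> {}"
    by (metis cardSuc_greater natLeq_Card_order Field_natLeq ordLess_imp_ordLeq
        card_of_empty3 card_of_mono2 UNIV_not_empty)
  then show ?thesis by blast
qed

lemma cardSuc_natLeq_Well_order: "Well_order (cardSuc natLeq)"
  by (simp add: cardSuc_Card_order natLeq_Card_order card_order_on_well_order_on)

instantiation omega1 :: wellorder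
begin

definition less_eq_omega1 :: "omega1 \<Rightarrow> omega1 \<Rightarrow> bool" where
  "x \<le> y \<longleftrightarrow> (Rep_omega1 x, Rep_omega1 y) \<in> cardSuc natLeq"

definition less_omega1 :: "omega1 \<Rightarrow> omega1 \<Rightarrow> bool" where
  "x < y \<longleftrightarrow> x \<le> y \<and> \<not> y \<le> x" for x y :: omega1

instance
proof
  let ?r = "cardSuc natLeq"
  note wo = cardSuc_natLeq_Well_order[unfolded well_order_on_def linear_order_on_def
      partial_order_on_def preorder_on_def]
  fix x y z :: omega1
  show "(x < y) = (x \<le> y \<and> \<not> y \<le> x)" by (simp add: less_omega1_def)
  show "x \<le> x" unfolding less_eq_omega1_def using wo Rep_omega1[of x] by (auto simp: refl_on_def)
  show "x \<le> z" if "x \<le> y" "y \<le> z"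
    using that wo unfolding less_eq_omega1_def by (blast dest: transD)
  show "x = y" if "x \<le> y" "y \<le> x"
    using that wo unfolding less_eq_omega1_def by (metis antisymD Rep_omega1_inject)
  show tot: "x \<le> y \<or> y \<le> x"
    using wo Rep_omega1[of x] Rep_omega1[of y] unfolding less_eq_omega1_def
    by (metis refl_onD total_on_def)
next
  fix Q :: "omega1 \<Rightarrow> bool" and x
  assume step: "\<And>x. (\<And>y. y < x \<Longrightarrow> Q y) \<Longrightarrow> Q x"
  let ?r = "cardSuc natLeq"
  have "wf (?r - Id)" using cardSuc_natLeq_Well_order by (simp add: well_order_on_def)
  then have "wf (inv_image (?r - Id) Rep_omega1)" by (rule wf_inv_image)
  moreover have "(y, x) \<in> inv_image (?r - Id) Rep_omega1" if "y < x" for x y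
    using that unfolding less_omega1_def less_eq_omega1_def by (auto simp: inv_image_def)
  ultimately show "Q x" using step by (induction x rule: wf_induct_rule) blast
qed

end

lemma uncountable_omega1: "uncountable (UNIV :: omega1 set)"
proof
  assume "countable (UNIV :: omega1 set)"
  then have "countable (Field (cardSuc natLeq))"
    by (metis countable_image type_definition.Rep_range type_definition_omega1)
  then have "|Field (cardSuc natLeq)| \<le>o natLeq"
    by (metis countable_card_of_nat card_of_nat ordLeq_ordIso_trans)
  then have "cardSuc natLeq \<le>o natLeq"
    by (metis cardSuc_Card_order natLeq_Card_order card_of_Field_ordIso ordIso_symmetric
        ordIso_ordLeq_trans)
  then show False
    using cardSuc_greater[OF natLeq_Card_order] not_ordLess_ordLeq by blast
qed

lemma countable_lessThan_omega1: "countable {..< x :: omega1}"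
proof -
  let ?r = "cardSuc natLeq"
  have "|underS ?r (Rep_omega1 x)| <o ?r"
    by (rule card_of_underS[OF cardSuc_Card_order[OF natLeq_Card_order] Rep_omega1])
  then have "|underS ?r (Rep_omega1 x)| \<le>o natLeq"
    using cardSuc_ordLeq_ordLess natLeq_Card_order card_of_Card_order by blast
  then have "countable (underS ?r (Rep_omega1 x))"
    by (metis countable_card_of_nat card_of_nat ordIso_symmetric ordLeq_ordIso_trans)
  moreover have "Rep_omega1 ` {..<x} \<subseteq> underS ?r (Rep_omega1 x)"
    by (auto simp: underS_def less_omega1_def less_eq_omega1_def)
  ultimately have "countable (Rep_omega1 ` {..<x})" by (rule countable_subset[rotated])
  then show ?thesis
    by (rule countable_image_inj_on) (meson Rep_omega1_inject inj_onI)
qed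


section \<open>Stationary sets, diamond, coherent sequences and the ScP\<close>

definition club :: "omega1 set \<Rightarrow> bool" where
  "club C \<longleftrightarrow> (\<forall>\<alpha>. \<exists>\<beta>\<in>C. \<alpha> < \<beta>) \<and>
     (\<forall>\<delta>. (\<exists>\<alpha>. \<alpha> < \<delta>) \<and> (\<forall>\<alpha><\<delta>. \<exists>\<beta>\<in>C. \<alpha> < \<beta> \<and> \<beta> < \<delta>) \<longrightarrow> \<delta> \<in> C)"

definition stationary :: "omega1 set \<Rightarrow> bool" where
  "stationary S \<longleftrightarrow> (\<forall>C. club C \<longrightarrow> (\<exists>\<alpha>\<in>C. \<alpha> \<in> S))"

definition diamond :: bool where
  "diamond \<longleftrightarrow> (\<exists>d :: omega1 \<Rightarrow> omega1 set. (\<forall>\<alpha>. d \<alpha> \<subseteq> {..<\<alpha>}) \<and>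
     (\<forall>X. stationary {\<alpha>. X \<inter> {..<\<alpha>} = d \<alpha>}))"

definition coherent :: "('i::wellorder \<Rightarrow> nat set) \<Rightarrow> bool" where
  "coherent a \<longleftrightarrow> (\<forall>\<alpha> \<beta>. \<alpha> \<le> \<beta> \<longrightarrow> (\<exists>F. finite F \<and> F \<subseteq> {..<\<alpha>} \<and>
     (a \<alpha> \<inter> a \<beta> \<subseteq> (\<Union>\<gamma>\<in>F. a \<gamma>) \<or> a \<alpha> \<subseteq> a \<beta> \<union> (\<Union>\<gamma>\<in>F. a \<gamma>))))"

definition proper_seq :: "('i::wellorder \<Rightarrow> nat set) \<Rightarrow> bool" where
  "proper_seq a \<longleftrightarrow> \<not> (\<exists>\<beta> F. finite F \<and> F \<subseteq> {..<\<beta>} \<and> a \<beta> \<subseteq> (\<Union>\<xi>\<in>F. a \<xi>))"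

definition hat :: "('i::wellorder \<Rightarrow> nat set) \<Rightarrow> 'i \<Rightarrow> 'i set" where
  "hat a \<beta> = {\<alpha>. \<alpha> \<le> \<beta> \<and> (\<exists>F. finite F \<and> F \<subseteq> {..<\<alpha>} \<and> a \<alpha> - a \<beta> \<subseteq> (\<Union>\<gamma>\<in>F. a \<gamma>))}"

definition cover :: "(omega1 \<Rightarrow> nat set) \<Rightarrow> omega1 set \<Rightarrow> bool" where
  "cover a S \<longleftrightarrow> (\<Union>\<gamma>\<in>S. hat a \<gamma>) = UNIV"

definition ScP :: "(omega1 \<Rightarrow> nat set) \<Rightarrow> bool" where
  "ScP a \<longleftrightarrow> (\<forall>S. stationary S \<longrightarrow> (\<exists>F. finite F \<and> cover a (S \<union> F)))"


section \<open>Forcing\<close>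

text \<open>
  A sentence of the forcing language of a forcing notion \<open>(P, le)\<close> is represented by the predicate
  ``\<open>p\<close> forces it''; smaller conditions are stronger. The connectives are the usual recursive
  clauses of the forcing relation, with disjunction, implication and existence defined classically
  from negation, conjunction and universal quantification.

  A name for a subset of the ground-model set \<open>X\<close> is a set of pairs \<open>(x, p)\<close> with \<open>x \<in> X\<close> and
  \<open>p \<in> P\<close>, that is, the \<open>P\<close>-name whose elements are the pairs of a canonical name \<open>check x\<close> and a
  condition. Every subset of \<open>X\<close> in a generic extension is the value of such a name, so \<open>fAllSet\<close>
  quantifies over all subsets of \<open>X\<close> that lie in the extension. In contrast \<open>fAll\<close> quantifies over
  the elements of a ground-model set (here \<open>\<omega>\<close> and \<open>\<omega>\<^sub>1\<close>), and \<open>fGround b\<close> is an atomic sentence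
  about such elements and the ground-model sequence, with truth value \<open>b\<close>.
\<close>

type_synonym 'p sentence = "'p \<Rightarrow> bool"
type_synonym ('x, 'p) name = "('x \<times> 'p) set"

definition fGround :: "bool \<Rightarrow> 'p sentence" where
  "fGround b = (\<lambda>p. b)"

definition fAnd :: "'p sentence \<Rightarrow> 'p sentence \<Rightarrow> 'p sentence" (infixr \<open>\<^bold>\<and>\<close> 35) where
  "(\<phi> \<^bold>\<and> \<psi>) = (\<lambda>p. \<phi> p \<and> \<psi> p)"

definition fAll :: "('x \<Rightarrow> 'p sentence) \<Rightarrow> 'p sentence" (binder \<open>\<^bold>\<forall>\<close> 10) where
  "(\<^bold>\<forall>x. \<phi> x) = (\<lambda>p. \<forall>x. \<phi> x p)"

locale forcing_notion =
  fixes P :: "'p set" and le :: "'p \<Rightarrow> 'p \<Rightarrow> bool"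
begin

definition fNot :: "'p sentence \<Rightarrow> 'p sentence" (\<open>\<^bold>\<not> _\<close> [40] 40) where
  "(\<^bold>\<not> \<phi>) = (\<lambda>p. \<forall>q\<in>P. le q p \<longrightarrow> \<not> \<phi> q)"

definition fMem :: "'x \<Rightarrow> ('x, 'p) name \<Rightarrow> 'p sentence" (infix \<open>\<^bold>\<in>\<close> 50) where
  "(x \<^bold>\<in> N) = (\<lambda>p. \<forall>q\<in>P. le q p \<longrightarrow> (\<exists>r\<in>P. le r q \<and> (\<exists>s. (x, s) \<in> N \<and> le r s)))"

definition fAllSet :: "(('x, 'p) name \<Rightarrow> 'p sentence) \<Rightarrow> 'p sentence"
    (binder \<open>\<^bold>\<forall>\<^sub>s\<close> 10) where
  "(\<^bold>\<forall>\<^sub>s N. \<phi> N) = (\<lambda>p. \<forall>N \<subseteq> UNIV \<times> P. \<phi> N p)"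

definition fOr :: "'p sentence \<Rightarrow> 'p sentence \<Rightarrow> 'p sentence" (infixr \<open>\<^bold>\<or>\<close> 30) where
  "(\<phi> \<^bold>\<or> \<psi>) = (\<^bold>\<not> (\<^bold>\<not> \<phi> \<^bold>\<and> \<^bold>\<not> \<psi>))"

definition fImp :: "'p sentence \<Rightarrow> 'p sentence \<Rightarrow> 'p sentence" (infixr \<open>\<^bold>\<longrightarrow>\<close> 25) where
  "(\<phi> \<^bold>\<longrightarrow> \<psi>) = (\<^bold>\<not> (\<phi> \<^bold>\<and> \<^bold>\<not> \<psi>))"

definition fIff :: "'p sentence \<Rightarrow> 'p sentence \<Rightarrow> 'p sentence" (infixr \<open>\<^bold>\<longleftrightarrow>\<close> 25) where
  "(\<phi> \<^bold>\<longleftrightarrow> \<psi>) = ((\<phi> \<^bold>\<longrightarrow> \<psi>) \<^bold>\<and> (\<psi> \<^bold>\<longrightarrow> \<phi>))"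

definition fEx :: "('x \<Rightarrow> 'p sentence) \<Rightarrow> 'p sentence" (binder \<open>\<^bold>\<exists>\<close> 10) where
  "(\<^bold>\<exists>x. \<phi> x) = (\<^bold>\<not> (\<^bold>\<forall>x. \<^bold>\<not> \<phi> x))"

definition fExSet :: "(('x, 'p) name \<Rightarrow> 'p sentence) \<Rightarrow> 'p sentence"
    (binder \<open>\<^bold>\<exists>\<^sub>s\<close> 10) where
  "(\<^bold>\<exists>\<^sub>s N. \<phi> N) = (\<^bold>\<not> (\<^bold>\<forall>\<^sub>s N. \<^bold>\<not> \<phi> N))"

definition forced :: "'p sentence \<Rightarrow> bool" where
  "forced \<phi> \<longleftrightarrow> (\<forall>p\<in>P. \<phi> p)"

subsection \<open>The ScP in the forcing language\<close>

text \<open>Sets named by subsets of \<open>\<omega> \<times> X\<close> serve as graphs of (partial) functions from \<open>\<omega>\<close> to \<open>X\<close>.\<close>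

definition f_function :: "(nat \<times> 'x, 'p) name \<Rightarrow> 'p sentence" where
  "f_function f = (\<^bold>\<forall>n x y. ((n, x) \<^bold>\<in> f \<^bold>\<and> (n, y) \<^bold>\<in> f) \<^bold>\<longrightarrow> fGround (x = y))"

text \<open>\<open>F\<close> is the image of \<open>{0, \<dots>, n - 1}\<close> under a partial function, for some \<open>n\<close>.\<close>

definition f_finite :: "('x, 'p) name \<Rightarrow> 'p sentence" where
  "f_finite F = (\<^bold>\<exists>n. \<^bold>\<exists>\<^sub>s f. f_function f \<^bold>\<and>
     (\<^bold>\<forall>x. x \<^bold>\<in> F \<^bold>\<longleftrightarrow> (\<^bold>\<exists>k. fGround (k < n) \<^bold>\<and> (k, x) \<^bold>\<in> f)))"

text \<open>\<open>\<omega>\<^sub>1\<close> of the ground model is still uncountable, hence is \<open>\<omega>\<^sub>1\<close> of the extension.\<close>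

definition f_omega1 :: "'p sentence" where
  "f_omega1 = (\<^bold>\<not> (\<^bold>\<exists>\<^sub>s f. f_function f \<^bold>\<and> (\<^bold>\<forall>(\<xi>::omega1). \<^bold>\<exists>n. (n, \<xi>) \<^bold>\<in> f)))"

definition f_club :: "(omega1, 'p) name \<Rightarrow> 'p sentence" where
  "f_club C = (
     (\<^bold>\<forall>\<alpha>. \<^bold>\<exists>\<beta>. \<beta> \<^bold>\<in> C \<^bold>\<and> fGround (\<alpha> < \<beta>)) \<^bold>\<and>
     (\<^bold>\<forall>\<delta>. ((\<^bold>\<exists>\<alpha>. fGround (\<alpha> < \<delta>)) \<^bold>\<and>
            (\<^bold>\<forall>\<alpha>. fGround (\<alpha> < \<delta>) \<^bold>\<longrightarrow> (\<^bold>\<exists>\<beta>. \<beta> \<^bold>\<in> C \<^bold>\<and> fGround (\<alpha> < \<beta>) \<^bold>\<and> fGround (\<beta> < \<delta>))))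
          \<^bold>\<longrightarrow> \<delta> \<^bold>\<in> C))"

definition f_stationary :: "(omega1, 'p) name \<Rightarrow> 'p sentence" where
  "f_stationary S = (\<^bold>\<forall>\<^sub>s C. f_club C \<^bold>\<longrightarrow> (\<^bold>\<exists>\<alpha>. \<alpha> \<^bold>\<in> C \<^bold>\<and> \<alpha> \<^bold>\<in> S))"

definition f_hat :: "(omega1 \<Rightarrow> nat set) \<Rightarrow> omega1 \<Rightarrow> omega1 \<Rightarrow> 'p sentence" where
  "f_hat a \<beta> \<alpha> = (fGround (\<alpha> \<le> \<beta>) \<^bold>\<and>
     (\<^bold>\<exists>\<^sub>s F. f_finite F \<^bold>\<and> (\<^bold>\<forall>\<gamma>. \<gamma> \<^bold>\<in> F \<^bold>\<longrightarrow> fGround (\<gamma> < \<alpha>)) \<^bold>\<and>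
        (\<^bold>\<forall>k. (fGround (k \<in> a \<alpha>) \<^bold>\<and> \<^bold>\<not> fGround (k \<in> a \<beta>)) \<^bold>\<longrightarrow>
             (\<^bold>\<exists>\<gamma>. \<gamma> \<^bold>\<in> F \<^bold>\<and> fGround (k \<in> a \<gamma>)))))"

definition f_ScP :: "(omega1 \<Rightarrow> nat set) \<Rightarrow> 'p sentence" where
  "f_ScP a = (f_omega1 \<^bold>\<and>
     (\<^bold>\<forall>\<^sub>s S. f_stationary S \<^bold>\<longrightarrow>
        (\<^bold>\<exists>\<^sub>s F. f_finite F \<^bold>\<and> (\<^bold>\<forall>\<alpha>. \<^bold>\<exists>\<gamma>. (\<gamma> \<^bold>\<in> S \<^bold>\<or> \<gamma> \<^bold>\<in> F) \<^bold>\<and> f_hat a \<gamma> \<alpha>))))"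

end

text \<open>Truth in every generic extension is being forced by every condition.\<close>

definition preserves_ScP :: "'p set \<Rightarrow> ('p \<Rightarrow> 'p \<Rightarrow> bool) \<Rightarrow> (omega1 \<Rightarrow> nat set) \<Rightarrow> bool" where
  "preserves_ScP P le a \<longleftrightarrow> forcing_notion.forced P (forcing_notion.f_ScP P le a)"


subsection \<open>Consistency check: over the trivial forcing notion \<open>f_ScP\<close> is the ScP\<close>

context
begin

interpretation T: forcing_notion "UNIV :: unit set" "\<lambda>_ _. True" .

private definition nm :: "'x set \<Rightarrow> ('x, unit) name" where "nm X = X \<times> UNIV"

private lemma mem_nm: "(x, u) \<in> nm X \<longleftrightarrow> x \<in> X"
  by (simp add: nm_def)

private lemma all_nm: "(\<forall>N. Q N) \<longleftrightarrow> (\<forall>X. Q (nm X))"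
proof -
  have "N = nm {x. (x, ()) \<in> N}" for N :: "('b, unit) name"
    by (auto simp: nm_def)
  then show ?thesis by metis
qed

private lemma trivial_not: "T.fNot \<phi> () \<longleftrightarrow> \<not> \<phi> ()"
  by (auto simp: T.fNot_def)

private lemma trivial_ground: "fGround b () \<longleftrightarrow> b"
  by (simp add: fGround_def)

private lemma trivial_and: "fAnd \<phi> \<psi> () \<longleftrightarrow> \<phi> () \<and> \<psi> ()"
  by (simp add: fAnd_def)

private lemma trivial_all: "(fAll \<Phi>) () \<longleftrightarrow> (\<forall>x. \<Phi> x ())"
  by (simp add: fAll_def)

private lemma trivial_mem: "T.fMem x (nm X) () \<longleftrightarrow> x \<in> X"
  by (simp add: T.fMem_def mem_nm)

private lemma trivial_allset: "T.fAllSet \<Psi> () \<longleftrightarrow> (\<forall>X. \<Psi> (nm X) ())"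
  using all_nm[of "\<lambda>N. \<Psi> N ()"] by (simp add: T.fAllSet_def)

private lemmas trivial_basic =
  trivial_not trivial_ground trivial_and trivial_all trivial_mem trivial_allset

private lemma trivial_derived:
  "T.fOr \<phi> \<psi> () \<longleftrightarrow> \<phi> () \<or> \<psi> ()"
  "T.fImp \<phi> \<psi> () \<longleftrightarrow> (\<phi> () \<longrightarrow> \<psi> ())"
  "T.fIff \<phi> \<psi> () \<longleftrightarrow> (\<phi> () \<longleftrightarrow> \<psi> ())"
  "T.fEx \<Phi> () \<longleftrightarrow> (\<exists>x. \<Phi> x ())"
  "T.fExSet \<Psi> () \<longleftrightarrow> (\<exists>X. \<Psi> (nm X) ())"
  by (auto simp: trivial_basic T.fOr_def T.fImp_def T.fIff_def T.fEx_def T.fExSet_def)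

private lemmas trivial_simps = trivial_basic trivial_derived

private lemma trivial_finite: "T.f_finite (nm F) () \<longleftrightarrow> finite F"
proof -
  have "T.f_finite (nm F) () \<longleftrightarrow> (\<exists>n::nat. \<exists>f. (\<forall>k x y. (k, x) \<in> f \<and> (k, y) \<in> f \<longrightarrow> x = y) \<and>
      (\<forall>x. x \<in> F \<longleftrightarrow> (\<exists>k<n. (k, x) \<in> f)))" (is "_ \<longleftrightarrow> (\<exists>n f. ?R n f)")
    by (simp add: T.f_finite_def T.f_function_def trivial_simps)
  also have "\<dots> \<longleftrightarrow> finite F"
  proof
    assume "\<exists>n f. ?R n f"
    then obtain n f where R: "?R n f" by blast
    have "F \<subseteq> (\<lambda>k. THE x. (k, x) \<in> f) ` {..<n}"
    proof
      fix x assume "x \<in> F"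
      then obtain k where k: "k < n" "(k, x) \<in> f" using R by blast
      then have "(THE x. (k, x) \<in> f) = x" using R by (intro the_equality) auto
      then show "x \<in> (\<lambda>k. THE x. (k, x) \<in> f) ` {..<n}" using k by force
    qed
    then show "finite F" using finite_surj by blast
  next
    assume "finite F"
    then obtain n :: nat and g where g: "F = g ` {i. i < n}"
      using finite_imp_nat_seg_image_inj_on by metis
    then have "?R n {(k, x). x = g k}" by auto
    then show "\<exists>n f. ?R n f" by blast
  qed
  finally show ?thesis .
qed

private lemma trivial_omega1: "T.f_omega1 ()"
proof -
  have "\<not> (\<forall>\<xi>. \<exists>n. (n, \<xi>) \<in> f)"
    if f: "\<forall>n x y. (n, x) \<in> f \<and> (n, y) \<in> f \<longrightarrow> x = y" for f :: "(nat \<times> omega1) set"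
  proof
    assume *: "\<forall>\<xi>. \<exists>n. (n, \<xi>) \<in> f"
    have "(UNIV :: omega1 set) \<subseteq> range (\<lambda>n. THE x. (n, x) \<in> f)"
    proof
      fix x
      obtain n where n: "(n, x) \<in> f" using * by blast
      then have "(THE x. (n, x) \<in> f) = x" using f by (intro the_equality) auto
      then show "x \<in> range (\<lambda>n. THE x. (n, x) \<in> f)" by (rule range_eqI[OF sym])
    qed
    then have "countable (UNIV :: omega1 set)" by (rule countable_subset) simp
    then show False using uncountable_omega1 by contradiction
  qed
  then have "\<not> (\<exists>f :: (nat \<times> omega1) set.
      (\<forall>n x y. (n, x) \<in> f \<and> (n, y) \<in> f \<longrightarrow> x = y) \<and> (\<forall>\<xi>. \<exists>n. (n, \<xi>) \<in> f))"
    by (intro notI, elim exE conjE) (rule notE)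
  then show ?thesis
    unfolding T.f_omega1_def T.f_function_def trivial_simps .
qed

private lemma trivial_club: "T.f_club (nm C) () \<longleftrightarrow> club C"
  unfolding T.f_club_def club_def trivial_simps Bex_def by (rule refl)

private lemma trivial_stationary: "T.f_stationary (nm S) () \<longleftrightarrow> stationary S"
  unfolding T.f_stationary_def stationary_def trivial_simps trivial_club Bex_def by (rule refl)

private lemma trivial_hat: "T.f_hat a \<beta> \<alpha> () \<longleftrightarrow> \<alpha> \<in> hat a \<beta>"
  unfolding T.f_hat_def hat_def trivial_simps trivial_finite by (simp add: subset_iff Bex_def)

lemma preserves_ScP_trivial: "preserves_ScP (UNIV :: unit set) (\<lambda>_ _. True) a \<longleftrightarrow> ScP a"
  unfolding preserves_ScP_def T.forced_def T.f_ScP_def ScP_def cover_def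
  by (simp add: trivial_simps trivial_finite trivial_stationary trivial_hat trivial_omega1
      set_eq_iff Bex_def conj_disj_distribR ex_disj_distrib)

end


section \<open>Free ultrafilters and the forcing \<open>\<L>(D)\<close>\<close>

definition free_ultrafilter :: "nat filter \<Rightarrow> bool" where
  "free_ultrafilter D \<longleftrightarrow> D \<noteq> bot \<and>
     (\<forall>Q. eventually Q D \<or> eventually (\<lambda>n. \<not> Q n) D) \<and> D \<le> cofinite"

definition succs :: "nat list set \<Rightarrow> nat list \<Rightarrow> nat set" where
  "succs T t = {j. t @ [j] \<in> T}"

definition branching :: "nat list set \<Rightarrow> nat list \<Rightarrow> bool" where
  "branching T t \<longleftrightarrow> t \<in> T \<and> (\<exists>i\<in>succs T t. \<exists>j\<in>succs T t. i \<noteq> j)"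

definition is_stem :: "nat list set \<Rightarrow> nat list \<Rightarrow> bool" where
  "is_stem T s \<longleftrightarrow> branching T s \<and> (\<forall>t. strict_prefix t s \<longrightarrow> \<not> branching T t)"

definition laver_forcing :: "nat filter \<Rightarrow> nat list set set" where
  "laver_forcing D = {T. (\<forall>t\<in>T. \<forall>s. prefix s t \<longrightarrow> s \<in> T) \<and>
     (\<exists>s. is_stem T s \<and> (\<forall>t\<in>T. prefix s t \<longrightarrow> eventually (\<lambda>j. j \<in> succs T t) D))}"

end

(* Under properness and coherence the sets hat a \<beta> are the basic compact open sets of a
   locally compact Hausdorff topology on \<omega>\<^sub>1, and the ScP makes this space sequentially compact.
   By CH (from diamond) a tower of infinite subsets of \<omega> generates an ultrafilter D such that every
   sequence of points has a D-limit. Given a name for a stationary set S, let S_t be the set of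
   \<gamma> that some condition with stem t forces into S. Some S_t is stationary, so S_t \<union> F is a
   cover for some finite F; D-limits show that S_u \<union> F is then a cover for D-many immediate
   successors u of t. Iterating, the nodes u with this property above t span a condition, and it
   forces that S \<union> F is a cover. *)
theory Submission
  imports Defs
begin

section \<open>Countable sets, clubs and stationary sets\<close>

lemma countable_bounded_omega1:
  fixes X :: "omega1 set"
  assumes "countable X"
  shows "\<exists>\<beta>. \<forall>\<alpha>\<in>X. \<alpha> < \<beta>"
proof (rule ccontr)
  assume "\<not> ?thesis"
  then have "UNIV = (\<Union>\<alpha>\<in>X. insert \<alpha> {..<\<alpha>})"
    by (force simp: not_less le_less)
  moreover have "countable (\<Union>\<alpha>\<in>X. insert \<alpha> {..<\<alpha>})"
    using assms by (intro countable_UN countable_insert countable_lessThan_omega1)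
  ultimately show False
    using uncountable_omega1 by simp
qed

text \<open>Unboundedness is a closing-off argument: \<open>G\<close> dominates the next-element
  functions of all the \<open>C i\<close> at once, so the supremum of its iterates is a limit of
  every \<open>C i\<close>.\<close>

lemma club_INT:
  fixes C :: "'i::countable \<Rightarrow> omega1 set"
  assumes C: "\<And>i. club (C i)"
  shows "club (\<Inter>i. C i)"
  unfolding club_def
proof (intro conjI allI impI)
  fix \<alpha>\<^sub>0 :: omega1
  have "\<exists>\<beta>\<in>C i. \<alpha> < \<beta>" for i \<alpha>
    using C unfolding club_def by blast
  then obtain nxt where nxt: "\<And>i \<alpha>. nxt i \<alpha> \<in> C i" "\<And>i \<alpha>. \<alpha> < nxt i \<alpha>"
    by metis
  have "\<exists>\<beta>. \<forall>i. nxt i \<alpha> < \<beta>" for \<alpha>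
    using countable_bounded_omega1[of "range (\<lambda>i. nxt i \<alpha>)"] by auto
  then obtain G where G: "\<And>i \<alpha>. nxt i \<alpha> < G \<alpha>"
    by metis
  define b where "b k = (G ^^ k) \<alpha>\<^sub>0" for k
  have b_Suc: "b (Suc k) = G (b k)" for k
    by (simp add: b_def)
  \<comment> \<open>As a least strict upper bound, \<beta> is a limit of the \<open>b k\<close>:
    anything below it is dominated by some \<open>b k\<close>, and \<open>nxt i (b k)\<close> lies
    before \<open>b (Suc k)\<close>.\<close>
  define \<beta> where "\<beta> = (LEAST \<beta>. \<forall>k. b k < \<beta>)"
  have "\<exists>\<beta>. \<forall>k. b k < \<beta>"
    using countable_bounded_omega1[of "range b"] by auto
  then have "\<forall>k. b k < \<beta>"
    unfolding \<beta>_def by (rule LeastI_ex)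
  then have b_less: "b k < \<beta>" for k
    by blast
  have cof: "\<exists>\<gamma>\<in>C i. \<alpha> < \<gamma> \<and> \<gamma> < \<beta>" if "\<alpha> < \<beta>" for \<alpha> i
  proof -
    have "\<not> (\<forall>k. b k < \<alpha>)"
      using that unfolding \<beta>_def by (rule not_less_Least)
    then obtain k where "\<alpha> \<le> b k"
      by (meson not_less)
    then show ?thesis
      using nxt(1)[of i "b k"] nxt(2)[of "b k" i] G[of i "b k"] b_less[of "Suc k"] b_Suc[of k]
      by (metis order.strict_trans order.strict_trans1)
  qed
  have "\<alpha>\<^sub>0 < \<beta>"
    using b_less[of 0] by (simp add: b_def)
  moreover have "\<beta> \<in> C i" for i
    using C[of i] cof \<open>\<alpha>\<^sub>0 < \<beta>\<close> unfolding club_def by blast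
  ultimately show "\<exists>\<beta>\<in>\<Inter>i. C i. \<alpha>\<^sub>0 < \<beta>"
    by blast
next
  fix \<delta>
  assume "(\<exists>\<alpha>. \<alpha> < \<delta>) \<and> (\<forall>\<alpha><\<delta>. \<exists>\<beta>\<in>\<Inter>i. C i. \<alpha> < \<beta> \<and> \<beta> < \<delta>)"
  then have "(\<exists>\<alpha>. \<alpha> < \<delta>) \<and> (\<forall>\<alpha><\<delta>. \<exists>\<beta>\<in>C i. \<alpha> < \<beta> \<and> \<beta> < \<delta>)" for i
    by blast
  then have "\<delta> \<in> C i" for i
    using C[of i] unfolding club_def by blast
  then show "\<delta> \<in> (\<Inter>i. C i)"
    by blast
qed

text \<open>Clubs missing the single sets intersect in a club missing the union. Below, the index
  \<open>i\<close> runs over finite lists: codes of finite sets, and later stems.\<close>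

lemma stationary_UN:
  fixes S :: "'i::countable \<Rightarrow> omega1 set"
  assumes "stationary (\<Union>i. S i)"
  shows "\<exists>i. stationary (S i)"
proof (rule ccontr)
  assume "\<not> ?thesis"
  then have "\<forall>i. \<exists>C. club C \<and> C \<inter> S i = {}"
    unfolding stationary_def by blast
  then obtain C where C: "\<And>i. club (C i)" "\<And>i. C i \<inter> S i = {}"
    unfolding choice_iff by blast
  have "club (\<Inter>i. C i)"
    using C(1) by (rule club_INT)
  then obtain \<alpha> where "\<alpha> \<in> (\<Inter>i. C i)" "\<alpha> \<in> (\<Union>i. S i)"
    using assms unfolding stationary_def by meson
  with C(2) show False
    by blast
qed

lemma stationary_UNIV: "stationary UNIV"
  unfolding stationary_def club_def by (metis UNIV_I)

lemma club_greaterThan: "club {\<beta>::omega1<..}"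
proof -
  have "\<exists>\<gamma>>\<beta>. \<alpha> < \<gamma>" for \<alpha>
    using countable_bounded_omega1[of "{\<alpha>, \<beta>}"] by auto
  moreover have "\<beta> < \<delta>" if "\<alpha> < \<delta>" "\<forall>\<alpha><\<delta>. \<exists>\<gamma>>\<beta>. \<alpha> < \<gamma> \<and> \<gamma> < \<delta>" for \<alpha> \<delta>
    using that by (meson order.strict_trans)
  ultimately show ?thesis
    unfolding club_def by fastforce
qed

text \<open>This is CH in the form that the tower needs. A sequence is coded by its graph; the code
  is countable, hence bounded, so a correct guess at a large enough index is the whole code.\<close>

lemma diamond_enumerates_sequences:
  assumes diamond
  shows "\<exists>e :: omega1 \<Rightarrow> nat \<Rightarrow> omega1. surj e"
proof -
  obtain d :: "omega1 \<Rightarrow> omega1 set"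
    where d: "\<And>X. stationary {\<alpha>. X \<inter> {..<\<alpha>} = d \<alpha>}"
    using assms unfolding diamond_def by blast
  have inf: "infinite (UNIV :: omega1 set)"
    using uncountable_omega1 countable_finite by blast
  then have "|UNIV :: nat set| \<le>o |UNIV :: omega1 set|"
    using infinite_iff_card_of_nat by blast
  then have "|(UNIV :: nat set) \<times> (UNIV :: omega1 set)| \<le>o |UNIV :: omega1 set|"
    using card_of_Times_infinite[OF inf, of "UNIV :: nat set"] ordIso_iff_ordLeq
    by (metis UNIV_not_empty card_of_Times_infinite_simps(3) inf)
  then obtain c :: "nat \<times> omega1 \<Rightarrow> omega1" where c: "inj c"
    by (auto simp: card_of_ordLeq[symmetric])
  have "\<exists>\<alpha>. f = (\<lambda>n. THE \<xi>. c (n, \<xi>) \<in> d \<alpha>)" for f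
  proof -
    define X where "X = range (\<lambda>n. c (n, f n))"
    obtain \<beta> where \<beta>: "\<forall>\<gamma>\<in>X. \<gamma> < \<beta>"
      using countable_bounded_omega1[of X] unfolding X_def by auto
    obtain \<alpha> where \<alpha>: "\<beta> < \<alpha>" "X \<inter> {..<\<alpha>} = d \<alpha>"
      using d[of X] club_greaterThan[of \<beta>] unfolding stationary_def by blast
    then have "d \<alpha> = X"
      using \<beta> by (auto intro: order.strict_trans)
    then have "c (n, \<xi>) \<in> d \<alpha> \<longleftrightarrow> \<xi> = f n" for n \<xi>
      using c by (auto simp: X_def inj_eq)
    then show ?thesis
      by (intro exI[of _ \<alpha>]) simp
  qed
  then show ?thesis
    by (intro exI[of _ "\<lambda>\<alpha> n. THE \<xi>. c (n, \<xi>) \<in> d \<alpha>"]) (simp add: surj_def)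
qed


section \<open>The space of a coherent sequence\<close>

text \<open>The filter on \<omega> generated by \<open>a \<alpha>\<close> and the complements of the
  earlier sets; it represents \<alpha> as a point of the space.\<close>

definition point_filter :: "('i::wellorder \<Rightarrow> nat set) \<Rightarrow> 'i \<Rightarrow> nat set set" where
  "point_filter a \<alpha> = {X. \<exists>F. finite F \<and> F \<subseteq> {..<\<alpha>} \<and> a \<alpha> - X \<subseteq> (\<Union>\<gamma>\<in>F. a \<gamma>)}"

lemma point_filter_Int:
  assumes "X \<in> point_filter a \<alpha>" "Y \<in> point_filter a \<alpha>"
  shows "X \<inter> Y \<in> point_filter a \<alpha>"
proof -
  obtain F G where "finite F" "F \<subseteq> {..<\<alpha>}" "a \<alpha> - X \<subseteq> (\<Union>\<gamma>\<in>F. a \<gamma>)"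
    "finite G" "G \<subseteq> {..<\<alpha>}" "a \<alpha> - Y \<subseteq> (\<Union>\<gamma>\<in>G. a \<gamma>)"
    using assms unfolding point_filter_def by blast
  then have "finite (F \<union> G) \<and> F \<union> G \<subseteq> {..<\<alpha>} \<and> a \<alpha> - X \<inter> Y \<subseteq> (\<Union>\<gamma>\<in>F \<union> G. a \<gamma>)"
    by auto
  then show ?thesis
    unfolding point_filter_def by blast
qed

lemma empty_notin_point_filter: "proper_seq a \<Longrightarrow> {} \<notin> point_filter a \<alpha>"
  unfolding proper_seq_def point_filter_def by auto

lemma compl_in_point_filter:
  assumes "\<beta> < \<alpha>"
  shows "- a \<beta> \<in> point_filter a \<alpha>"
proof -
  have "finite {\<beta>} \<and> {\<beta>} \<subseteq> {..<\<alpha>} \<and> a \<alpha> - - a \<beta> \<subseteq> (\<Union>\<gamma>\<in>{\<beta>}. a \<gamma>)"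
    using assms by auto
  then show ?thesis
    unfolding point_filter_def by blast
qed

text \<open>For \<beta> < \<alpha> the filter contains the complement of \<open>a \<beta>\<close>,
  so by properness not \<open>a \<beta>\<close>. The bound \<open>\<alpha> \<le> \<beta>\<close> in
  \<open>hat\<close> is therefore automatic.\<close>

lemma hat_iff_point_filter:
  assumes "proper_seq a"
  shows "\<alpha> \<in> hat a \<beta> \<longleftrightarrow> a \<beta> \<in> point_filter a \<alpha>"
proof (cases "\<alpha> \<le> \<beta>")
  case True
  then show ?thesis
    by (simp add: hat_def point_filter_def)
next
  case False
  then have "a \<beta> \<notin> point_filter a \<alpha>"
    using point_filter_Int[OF _ compl_in_point_filter[of \<beta> \<alpha> a]] empty_notin_point_filter[OF assms]
    by (metis Compl_disjoint not_le)
  with False show ?thesis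
    by (simp add: hat_def)
qed

text \<open>Coherence makes each point filter decide every \<open>a \<beta>\<close>, so the
  complement of a hat is given by a filter condition too: hats are clopen.\<close>

lemma not_hat_iff_point_filter:
  assumes "proper_seq a" "coherent a"
  shows "\<alpha> \<notin> hat a \<beta> \<longleftrightarrow> - a \<beta> \<in> point_filter a \<alpha>"
proof
  assume "\<alpha> \<notin> hat a \<beta>"
  show "- a \<beta> \<in> point_filter a \<alpha>"
  proof (cases "\<alpha> \<le> \<beta>")
    case True
    then obtain F where F: "finite F" "F \<subseteq> {..<\<alpha>}"
      "a \<alpha> \<inter> a \<beta> \<subseteq> (\<Union>\<gamma>\<in>F. a \<gamma>) \<or> a \<alpha> \<subseteq> a \<beta> \<union> (\<Union>\<gamma>\<in>F. a \<gamma>)"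
      using assms(2) unfolding coherent_def by metis
    moreover have "\<not> a \<alpha> - a \<beta> \<subseteq> (\<Union>\<gamma>\<in>F. a \<gamma>)"
      using F True \<open>\<alpha> \<notin> hat a \<beta>\<close> unfolding hat_def by blast
    ultimately have "a \<alpha> - - a \<beta> \<subseteq> (\<Union>\<gamma>\<in>F. a \<gamma>)"
      by blast
    with F show ?thesis
      unfolding point_filter_def by blast
  qed (simp add: compl_in_point_filter)
next
  assume "- a \<beta> \<in> point_filter a \<alpha>"
  then show "\<alpha> \<notin> hat a \<beta>"
    using point_filter_Int[of "a \<beta>" a \<alpha> "- a \<beta>"] empty_notin_point_filter[OF assms(1)]
    by (auto simp: hat_iff_point_filter[OF assms(1)])
qed

lemma compl_UN_in_point_filter:
  assumes "proper_seq a" "coherent a" "finite F" "\<alpha> \<notin> (\<Union>\<xi>\<in>F. hat a \<xi>)"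
  shows "- (\<Union>\<xi>\<in>F. a \<xi>) \<in> point_filter a \<alpha>"
  using assms(3,4)
proof (induction F)
  case empty
  have "UNIV \<in> point_filter a \<alpha>"
    unfolding point_filter_def by auto
  then show ?case
    by simp
next
  case (insert \<xi> F)
  then show ?case
    using point_filter_Int not_hat_iff_point_filter[OF assms(1,2)] by auto
qed

text \<open>A point violating the conclusion would have the empty set in its filter. This and the
  next lemma turn the two alternatives of coherence into statements about hats.\<close>

lemma hat_subset_UN:
  assumes "proper_seq a" "coherent a" "finite F" "a \<gamma> \<subseteq> a \<beta> \<union> (\<Union>\<xi>\<in>F. a \<xi>)"
  shows "hat a \<gamma> \<subseteq> hat a \<beta> \<union> (\<Union>\<xi>\<in>F. hat a \<xi>)"
proof
  fix \<alpha>
  assume \<alpha>: "\<alpha> \<in> hat a \<gamma>"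
  show "\<alpha> \<in> hat a \<beta> \<union> (\<Union>\<xi>\<in>F. hat a \<xi>)"
  proof (rule ccontr)
    assume "\<not> ?thesis"
    then have "- a \<beta> \<inter> - (\<Union>\<xi>\<in>F. a \<xi>) \<in> point_filter a \<alpha>"
      using assms by (intro point_filter_Int compl_UN_in_point_filter)
        (auto simp: not_hat_iff_point_filter)
    then have "a \<gamma> \<inter> (- a \<beta> \<inter> - (\<Union>\<xi>\<in>F. a \<xi>)) \<in> point_filter a \<alpha>"
      using \<alpha> hat_iff_point_filter[OF assms(1)] point_filter_Int by blast
    moreover have "a \<gamma> \<inter> (- a \<beta> \<inter> - (\<Union>\<xi>\<in>F. a \<xi>)) = {}"
      using assms(4) by blast
    ultimately show False
      using empty_notin_point_filter[OF assms(1)] by metis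
  qed
qed

lemma hat_Int_subset_UN:
  assumes "proper_seq a" "coherent a" "finite F" "a \<gamma> \<inter> a \<beta> \<subseteq> (\<Union>\<xi>\<in>F. a \<xi>)"
  shows "hat a \<gamma> \<inter> hat a \<beta> \<subseteq> (\<Union>\<xi>\<in>F. hat a \<xi>)"
proof
  fix \<alpha>
  assume \<alpha>: "\<alpha> \<in> hat a \<gamma> \<inter> hat a \<beta>"
  show "\<alpha> \<in> (\<Union>\<xi>\<in>F. hat a \<xi>)"
  proof (rule ccontr)
    assume "\<not> ?thesis"
    then have "(a \<gamma> \<inter> a \<beta>) \<inter> - (\<Union>\<xi>\<in>F. a \<xi>) \<in> point_filter a \<alpha>"
      using assms \<alpha> by (intro point_filter_Int compl_UN_in_point_filter)
        (auto simp: hat_iff_point_filter)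
    moreover have "(a \<gamma> \<inter> a \<beta>) \<inter> - (\<Union>\<xi>\<in>F. a \<xi>) = {}"
      using assms(4) by blast
    ultimately show False
      using empty_notin_point_filter[OF assms(1)] by metis
  qed
qed

section \<open>Sequential compactness from the ScP\<close>

lemma self_in_hat: "\<gamma> \<in> hat a \<gamma>"
  unfolding hat_def by auto

text \<open>If every hat met only finitely many terms, the finite index set
  \<open>H \<gamma>\<close> would be the same for stationarily many \<gamma>. Adding the finite
  \<open>F\<close> of the ScP still reaches only finitely many indices, although all of
  \<open>A\<close> must be reached.\<close>

lemma ScP_accumulation:
  fixes f :: "nat \<Rightarrow> omega1"
  assumes "ScP a" "infinite A"
  shows "\<exists>\<gamma>. infinite {j\<in>A. f j \<in> hat a \<gamma>}"
proof (rule ccontr)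
  assume contra: "\<not> ?thesis"
  define H where "H \<gamma> = {j\<in>A. f j \<in> hat a \<gamma>}" for \<gamma>
  \<comment> \<open>Lists serve as countably many codes for the finite sets of indices.\<close>
  define S where "S i = {\<gamma>. H \<gamma> = set i}" for i
  have "\<exists>i. \<gamma> \<in> S i" for \<gamma>
    using contra finite_list[of "H \<gamma>"] unfolding H_def S_def by force
  then have "(\<Union>i. S i) = UNIV"
    by blast
  then obtain i where "stationary (S i)"
    using stationary_UN[of S] stationary_UNIV by metis
  then obtain F where F: "finite F" "cover a (S i \<union> F)"
    using assms(1) unfolding ScP_def by blast
  have "A - set i \<subseteq> (\<Union>\<gamma>\<in>F. H \<gamma>)"
  proof
    fix j
    assume j: "j \<in> A - set i"
    obtain \<gamma> where "\<gamma> \<in> S i \<union> F" "f j \<in> hat a \<gamma>"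
      using F(2) unfolding cover_def by blast
    with j show "j \<in> (\<Union>\<gamma>\<in>F. H \<gamma>)"
      unfolding H_def S_def by blast
  qed
  moreover have "finite (\<Union>\<gamma>\<in>F. H \<gamma>)"
    using F(1) contra unfolding H_def by blast
  ultimately show False
    using assms(2) by (meson List.finite_set finite_Diff2 finite_subset)
qed

text \<open>Convergence of \<open>f\<close> along \<open>B\<close> to \<open>x\<close>: hats are
  clopen, so membership in each of them must stabilise at its value for \<open>x\<close>.\<close>

definition hat_limit :: "(omega1 \<Rightarrow> nat set) \<Rightarrow> (nat \<Rightarrow> omega1) \<Rightarrow> nat set \<Rightarrow> omega1 \<Rightarrow> bool" where
  "hat_limit a f B x \<longleftrightarrow> (\<forall>\<gamma>. finite {j\<in>B. \<not> (f j \<in> hat a \<gamma> \<longleftrightarrow> x \<in> hat a \<gamma>)})"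

text \<open>The least \<open>\<gamma>\<close> whose compact open set \<open>hat a \<gamma>\<close> contains infinitely many terms is already
  the limit of these terms: by coherence every neighbourhood of \<open>\<gamma>\<close> contains \<open>hat a \<gamma>\<close> up to
  finitely many \<open>hat a \<xi>\<close> with \<open>\<xi> < \<gamma>\<close>.\<close>

lemma ScP_convergent_subsequence:
  assumes "proper_seq a" "coherent a" "ScP a" "infinite A"
  shows "\<exists>B x. B \<subseteq> A \<and> infinite B \<and> hat_limit a f B x"
proof -
  define \<gamma> where "\<gamma> = (LEAST \<gamma>. infinite {j\<in>A. f j \<in> hat a \<gamma>})"
  define B where "B = {j\<in>A. f j \<in> hat a \<gamma>}"
  have inf: "infinite B"
    unfolding B_def \<gamma>_def using ScP_accumulation[OF assms(3,4)] by (rule LeastI_ex)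
  have small: "finite {j\<in>A. f j \<in> hat a \<xi>}" if "\<xi> < \<gamma>" for \<xi>
    using that not_less_Least unfolding \<gamma>_def by blast
  have small': "finite {j\<in>A. f j \<in> (\<Union>\<xi>\<in>F. hat a \<xi>)}" if "finite F" "F \<subseteq> {..<\<gamma>}" for F
  proof -
    have "{j\<in>A. f j \<in> (\<Union>\<xi>\<in>F. hat a \<xi>)} = (\<Union>\<xi>\<in>F. {j\<in>A. f j \<in> hat a \<xi>})"
      by blast
    then show ?thesis
      using that small by auto
  qed
  have "finite {j\<in>B. \<not> (f j \<in> hat a \<beta> \<longleftrightarrow> \<gamma> \<in> hat a \<beta>)}" for \<beta>
  proof (cases "\<beta> < \<gamma>")
    case True
    then have "\<gamma> \<notin> hat a \<beta>"
      unfolding hat_def by auto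
    then have "{j\<in>B. \<not> (f j \<in> hat a \<beta> \<longleftrightarrow> \<gamma> \<in> hat a \<beta>)} \<subseteq> {j\<in>A. f j \<in> hat a \<beta>}"
      unfolding B_def by blast
    then show ?thesis
      using small[OF True] finite_subset by blast
  next
    case False
    then obtain F where F: "finite F" "F \<subseteq> {..<\<gamma>}"
      "a \<gamma> \<inter> a \<beta> \<subseteq> (\<Union>\<xi>\<in>F. a \<xi>) \<or> a \<gamma> \<subseteq> a \<beta> \<union> (\<Union>\<xi>\<in>F. a \<xi>)"
      using assms(2) unfolding coherent_def by (metis not_less)
    have \<gamma>: "\<gamma> \<in> hat a \<gamma>" "\<gamma> \<notin> (\<Union>\<xi>\<in>F. hat a \<xi>)"
      using F(2) self_in_hat[of \<gamma> a] unfolding hat_def by auto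
    have "hat a \<gamma> \<inter> hat a \<beta> \<subseteq> (\<Union>\<xi>\<in>F. hat a \<xi>) \<or> hat a \<gamma> \<subseteq> hat a \<beta> \<union> (\<Union>\<xi>\<in>F. hat a \<xi>)"
      using F(3) hat_Int_subset_UN[OF assms(1,2) F(1), of \<gamma> \<beta>]
        hat_subset_UN[OF assms(1,2) F(1), of \<gamma> \<beta>] by argo
    then have "{j\<in>B. \<not> (f j \<in> hat a \<beta> \<longleftrightarrow> \<gamma> \<in> hat a \<beta>)} \<subseteq> {j\<in>A. f j \<in> (\<Union>\<xi>\<in>F. hat a \<xi>)}"
      using \<gamma> unfolding B_def by blast
    then show ?thesis
      using small'[OF F(1,2)] finite_subset by blast
  qed
  then have "hat_limit a f B \<gamma>"
    by (simp add: hat_limit_def)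
  moreover have "B \<subseteq> A"
    unfolding B_def by blast
  ultimately show ?thesis
    using inf by blast
qed


section \<open>An ultrafilter with respect to which the space is compact\<close>

text \<open>Diagonalisation: \<open>g n\<close> is at least \<open>n\<close> and lies in the first
  \<open>n + 1\<close> sets of an enumeration, so only finitely many of its values miss a given
  set.\<close>

lemma pseudo_intersection:
  fixes A :: "'i \<Rightarrow> nat set"
  assumes "countable I" and inf: "\<And>J. finite J \<Longrightarrow> J \<subseteq> I \<Longrightarrow> infinite (\<Inter>i\<in>J. A i)"
  shows "\<exists>B. infinite B \<and> (\<forall>i\<in>I. finite (B - A i))"
proof (cases "I = {}")
  case True
  then show ?thesis
    by (intro exI[of _ UNIV]) simp
next
  case False
  define e where "e = from_nat_into I"
  have e: "e k \<in> I" for k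
    using False unfolding e_def by (rule from_nat_into)
  have "\<exists>m\<ge>n. m \<in> (\<Inter>i\<in>e ` {..n}. A i)" for n
    using inf[of "e ` {..n}"] e infinite_nat_iff_unbounded_le by blast
  then obtain g where g: "\<And>n. n \<le> g n" "\<And>n. g n \<in> (\<Inter>i\<in>e ` {..n}. A i)"
    by metis
  have "infinite (range g)"
    unfolding infinite_nat_iff_unbounded_le using g(1) by blast
  moreover have "finite (range g - A i)" if i: "i \<in> I" for i
  proof -
    obtain k where k: "e k = i"
      using i assms(1) from_nat_into_surj unfolding e_def by metis
    have "range g - A i \<subseteq> g ` {..<k}"
    proof clarify
      fix n
      assume "g n \<notin> A i"
      then have "\<not> k \<le> n"
        using g(2)[of n] k by auto
      then show "g n \<in> g ` {..<k}"
        by simp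
    qed
    then show ?thesis
      using finite_subset by blast
  qed
  ultimately show ?thesis
    by blast
qed

text \<open>The set with the largest index is almost contained in all the others, so the
  intersection keeps all but finitely many of its elements.\<close>

lemma tower_Inter_infinite:
  fixes A :: "'i::linorder \<Rightarrow> 'a set"
  assumes "finite J" "J \<noteq> {}" and inf: "\<And>i. i \<in> J \<Longrightarrow> infinite (A i)"
    and dec: "\<And>i j. i \<in> J \<Longrightarrow> j \<in> J \<Longrightarrow> i < j \<Longrightarrow> finite (A j - A i)"
  shows "infinite (\<Inter>i\<in>J. A i)"
proof
  assume fin: "finite (\<Inter>i\<in>J. A i)"
  define m where "m = Max J"
  have m: "m \<in> J"
    using assms unfolding m_def by simp
  have "finite (A m - A i)" if "i \<in> J" for i
    using that dec[OF that m] Max_ge[OF \<open>finite J\<close> that] unfolding m_def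
    by (cases "i = Max J") auto
  then have "finite ((\<Inter>i\<in>J. A i) \<union> (\<Union>i\<in>J. A m - A i))"
    using fin \<open>finite J\<close> by (intro finite_UnI finite_UN_I)
  moreover have "A m \<subseteq> (\<Inter>i\<in>J. A i) \<union> (\<Union>i\<in>J. A m - A i)"
    by blast
  ultimately show False
    using inf[OF m] finite_subset by blast
qed

text \<open>Each stage of the recursion has only countably many predecessors; these have a
  pseudo-intersection, which is then shrunk to meet the requirement \<open>Q \<xi>\<close>.\<close>

lemma tower_exists:
  fixes Q :: "omega1 \<Rightarrow> nat set \<Rightarrow> bool"
  assumes Q: "\<And>\<xi> A. infinite A \<Longrightarrow> \<exists>B\<subseteq>A. infinite B \<and> Q \<xi> B"
  shows "\<exists>A. (\<forall>\<xi>. infinite (A \<xi>) \<and> Q \<xi> (A \<xi>)) \<and> (\<forall>\<eta> \<xi>. \<eta> < \<xi> \<longrightarrow> finite (A \<xi> - A \<eta>))"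
proof -
  \<comment> \<open>\<open>R A \<xi> B\<close> says that \<open>B\<close> is a correct choice at
    stage \<xi>. It looks at \<open>A\<close> only below \<xi>, as well-founded choice
    demands.\<close>
  define R where "R A \<xi> B \<longleftrightarrow> infinite B \<and> Q \<xi> B \<and> (\<forall>\<eta><\<xi>. finite (B - A \<eta>))"
    for A \<xi> and B :: "nat set"
  have "\<exists>A. \<forall>\<xi>. R A \<xi> (A \<xi>)"
  proof (rule dependent_wf_choice[of "{(x, y). x < y}"])
    show "wf {(x, y :: omega1). x < y}"
      by (rule wf)
  next
    fix f g :: "omega1 \<Rightarrow> nat set" and x r
    assume "\<And>z. (z, x) \<in> {(x, y). x < y} \<Longrightarrow> f z = g z"
    then show "R f x r = R g x r"
      unfolding R_def by auto
  next
    fix \<xi> A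
    assume "\<And>\<eta>. (\<eta>, \<xi>) \<in> {(x, y). x < y} \<Longrightarrow> R A \<eta> (A \<eta>)"
    then have A: "infinite (A \<eta>)" "\<zeta> < \<eta> \<Longrightarrow> finite (A \<eta> - A \<zeta>)" if "\<eta> < \<xi>" for \<eta> \<zeta>
      using that unfolding R_def by auto
    have "\<exists>B. infinite B \<and> (\<forall>\<eta>\<in>{..<\<xi>}. finite (B - A \<eta>))"
    proof (rule pseudo_intersection[OF countable_lessThan_omega1])
      fix J :: "omega1 set"
      assume "finite J" "J \<subseteq> {..<\<xi>}"
      then show "infinite (\<Inter>\<eta>\<in>J. A \<eta>)"
      proof (cases "J = {}")
        case False
        with \<open>finite J\<close> show ?thesis
          by (rule tower_Inter_infinite) (use \<open>J \<subseteq> {..<\<xi>}\<close> A in blast)+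
      qed simp
    qed
    then obtain B where B: "infinite B" "\<And>\<eta>. \<eta> < \<xi> \<Longrightarrow> finite (B - A \<eta>)"
      by auto
    obtain B' where "B' \<subseteq> B" "infinite B'" "Q \<xi> B'"
      using Q[OF B(1)] by blast
    moreover from this have "finite (B' - A \<eta>)" if "\<eta> < \<xi>" for \<eta>
      using B(2)[OF that] by (meson Diff_mono finite_subset order_refl)
    ultimately show "\<exists>B. R A \<xi> B"
      unfolding R_def by blast
  qed
  then show ?thesis
    unfolding R_def by blast
qed

text \<open>A witness \<xi> may be replaced by any larger index, so two witnesses can be moved to
  their maximum; this gives closure under intersection.\<close>

lemma eventually_tower_filter:
  fixes A :: "'i::linorder \<Rightarrow> 'a set"
  assumes dec: "\<And>\<eta> \<xi>. \<eta> < \<xi> \<Longrightarrow> finite (A \<xi> - A \<eta>)"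
  shows "\<exists>D. \<forall>Q. eventually Q D \<longleftrightarrow> (\<exists>\<xi>. finite {n\<in>A \<xi>. \<not> Q n})"
proof -
  have step: "finite {n\<in>A (max \<xi> \<eta>). \<not> Q n}" if "finite {n\<in>A \<xi>. \<not> Q n}" for \<xi> \<eta> Q
  proof -
    have "finite (A (max \<xi> \<eta>) - A \<xi>)"
      using dec[of \<xi> "max \<xi> \<eta>"] by (cases "\<xi> < max \<xi> \<eta>") (auto simp: max_def)
    then have "finite ((A (max \<xi> \<eta>) - A \<xi>) \<union> {n\<in>A \<xi>. \<not> Q n})"
      using that by simp
    then show ?thesis
      by (rule rev_finite_subset) blast
  qed
  have "is_filter (\<lambda>Q. \<exists>\<xi>. finite {n\<in>A \<xi>. \<not> Q n})"
  proof
    show "\<exists>\<xi>. finite {n\<in>A \<xi>. \<not> True}"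
      by simp
  next
    fix P Q
    assume "\<exists>\<xi>. finite {n\<in>A \<xi>. \<not> P n}" "\<exists>\<xi>. finite {n\<in>A \<xi>. \<not> Q n}"
    then obtain \<xi> \<eta> where "finite {n\<in>A \<xi>. \<not> P n}" "finite {n\<in>A \<eta>. \<not> Q n}"
      by blast
    then have "finite ({n\<in>A (max \<xi> \<eta>). \<not> P n} \<union> {n\<in>A (max \<xi> \<eta>). \<not> Q n})"
      using step[of \<xi> P \<eta>] step[of \<eta> Q \<xi>] by (simp add: max.commute)
    then have "finite {n\<in>A (max \<xi> \<eta>). \<not> (P n \<and> Q n)}"
      by (rule rev_finite_subset) blast
    then show "\<exists>\<xi>. finite {n\<in>A \<xi>. \<not> (P n \<and> Q n)}"
      by blast
  next
    fix P Q
    assume imp: "\<forall>n. P n \<longrightarrow> Q n" and "\<exists>\<xi>. finite {n\<in>A \<xi>. \<not> P n}"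
    then obtain \<xi> where "finite {n\<in>A \<xi>. \<not> P n}"
      by blast
    then have "finite {n\<in>A \<xi>. \<not> Q n}"
      by (rule rev_finite_subset) (use imp in blast)
    then show "\<exists>\<xi>. finite {n\<in>A \<xi>. \<not> Q n}"
      by blast
  qed
  then show ?thesis
    using eventually_Abs_filter by blast
qed

text \<open>Stage \<xi> of the tower makes the sequence \<open>e \<xi>\<close> converge. As
  \<open>e\<close> lists all sequences, each of them converges along a tower member and hence along
  \<open>D\<close>.\<close>

lemma hat_compact_ultrafilter:
  assumes diamond "proper_seq a" "coherent a" "ScP a"
  shows "\<exists>D. free_ultrafilter D \<and>
    (\<forall>f. \<exists>x. \<forall>\<gamma>. eventually (\<lambda>j. f j \<in> hat a \<gamma> \<longleftrightarrow> x \<in> hat a \<gamma>) D)"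
proof -
  obtain e :: "omega1 \<Rightarrow> nat \<Rightarrow> omega1" where e: "surj e"
    using diamond_enumerates_sequences[OF assms(1)] by blast
  obtain A where A: "\<And>\<xi>. infinite (A \<xi>)" "\<And>\<xi>. \<exists>x. hat_limit a (e \<xi>) (A \<xi>) x"
    "\<And>\<eta> \<xi>. \<eta> < \<xi> \<Longrightarrow> finite (A \<xi> - A \<eta>)"
    using tower_exists[of "\<lambda>\<xi> B. \<exists>x. hat_limit a (e \<xi>) B x"]
      ScP_convergent_subsequence[OF assms(2-4)] by metis
  obtain D where D: "\<And>Q. eventually Q D \<longleftrightarrow> (\<exists>\<xi>. finite {n\<in>A \<xi>. \<not> Q n})"
    using eventually_tower_filter[of A] A(3) by metis
  have lim: "\<exists>x. \<forall>\<gamma>. eventually (\<lambda>j. f j \<in> hat a \<gamma> \<longleftrightarrow> x \<in> hat a \<gamma>) D" for f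
  proof -
    obtain \<xi> where "f = e \<xi>"
      using e by (metis surjD)
    then show ?thesis
      using A(2)[of \<xi>] unfolding D hat_limit_def by blast
  qed
  have "\<not> eventually (\<lambda>_. False) D"
    unfolding D using A(1) by simp
  then have "D \<noteq> bot"
    by auto
  moreover have "eventually Q D \<or> eventually (\<lambda>n. \<not> Q n) D" for Q
  proof -
    \<comment> \<open>The limits also yield the ultrafilter property: two points separated by
      \<open>hat a \<alpha>\<close> turn \<open>Q\<close> into a two-valued sequence, and its limit
      decides \<open>Q\<close>.\<close>
    obtain \<alpha> \<beta> :: omega1 where "\<alpha> < \<beta>"
      using countable_bounded_omega1[of "{undefined}"] by auto
    then have \<alpha>\<beta>: "\<alpha> \<in> hat a \<alpha>" "\<beta> \<notin> hat a \<alpha>"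
      using self_in_hat[of \<alpha> a] unfolding hat_def by auto
    obtain x where "eventually (\<lambda>j. (if Q j then \<alpha> else \<beta>) \<in> hat a \<alpha> \<longleftrightarrow> x \<in> hat a \<alpha>) D"
      using lim[of "\<lambda>j. if Q j then \<alpha> else \<beta>"] by blast
    then have "eventually (\<lambda>j. Q j \<longleftrightarrow> x \<in> hat a \<alpha>) D"
      by (rule eventually_mono) (use \<alpha>\<beta> in \<open>simp split: if_splits\<close>)
    then show ?thesis
      by (cases "x \<in> hat a \<alpha>") auto
  qed
  moreover have "D \<le> cofinite"
    unfolding le_filter_def D eventually_cofinite
    by (metis (no_types, lifting) Collect_mono finite_subset)
  ultimately show ?thesis
    using lim unfolding free_ultrafilter_def by blast
qed


section \<open>Forcing with names for ground model sets\<close>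

locale forcing_preorder = forcing_notion P le for P :: "'p set" and le +
  assumes le_refl: "p \<in> P \<Longrightarrow> le p p"
    and le_trans: "le p q \<Longrightarrow> le q r \<Longrightarrow> le p r"
begin

text \<open>The standard name of a ground-model set; pairing with every condition avoids a largest
  one.\<close>

definition check :: "'x set \<Rightarrow> ('x, 'p) name" where
  "check X = X \<times> P"

text \<open>Absoluteness: all conditions agree with the ground-model truth value \<open>b\<close>.
  In particular \<open>decided \<phi> False\<close> means that no condition forces \<phi>, so every
  condition forces its negation.\<close>

definition decided :: "'p sentence \<Rightarrow> bool \<Rightarrow> bool" where
  "decided \<phi> b \<longleftrightarrow> (\<forall>p\<in>P. \<phi> p \<longleftrightarrow> b)"

lemma check_subset: "check X \<subseteq> UNIV \<times> P"
  unfolding check_def by blast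

lemma decidedD: "decided \<phi> True \<Longrightarrow> p \<in> P \<Longrightarrow> \<phi> p"
  unfolding decided_def by blast

section \<open>The classical connectives as density statements\<close>

lemma fOr_iff: "fOr \<phi> \<psi> p \<longleftrightarrow> (\<forall>q\<in>P. le q p \<longrightarrow> (\<exists>r\<in>P. le r q \<and> (\<phi> r \<or> \<psi> r)))"
  unfolding fOr_def fNot_def fAnd_def by (meson le_refl le_trans)

lemma fImp_iff: "fImp \<phi> \<psi> p \<longleftrightarrow> (\<forall>q\<in>P. le q p \<longrightarrow> \<phi> q \<longrightarrow> (\<exists>r\<in>P. le r q \<and> \<psi> r))"
  unfolding fImp_def fNot_def fAnd_def by meson

lemma fEx_iff: "fEx \<Phi> p \<longleftrightarrow> (\<forall>q\<in>P. le q p \<longrightarrow> (\<exists>x. \<exists>r\<in>P. le r q \<and> \<Phi> x r))"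
  unfolding fEx_def fNot_def fAll_def by meson

lemma fExSet_iff:
  "fExSet \<Psi> p \<longleftrightarrow> (\<forall>q\<in>P. le q p \<longrightarrow> (\<exists>N\<subseteq>UNIV \<times> P. \<exists>r\<in>P. le r q \<and> \<Psi> N r))"
  unfolding fExSet_def fNot_def fAllSet_def by meson

lemma fMem_mono: "fMem x N p \<Longrightarrow> le q p \<Longrightarrow> fMem x N q"
  unfolding fMem_def by (meson le_trans)

lemma fOr_fMemI: "fMem x N p \<or> fMem x M p \<Longrightarrow> fOr (fMem x N) (fMem x M) p"
  unfolding fOr_iff by (meson fMem_mono le_refl)

lemma fExSetI:
  "N \<subseteq> UNIV \<times> P \<Longrightarrow> (\<And>q. q \<in> P \<Longrightarrow> le q p \<Longrightarrow> \<Psi> N q) \<Longrightarrow> fExSet \<Psi> p"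
  unfolding fExSet_iff using le_refl by blast

section \<open>Absoluteness of sentences about ground-model sets\<close>

lemma decided_Ground: "decided (fGround b) b"
  unfolding decided_def fGround_def by blast

lemma decided_And: "decided \<phi> b \<Longrightarrow> decided \<psi> c \<Longrightarrow> decided (fAnd \<phi> \<psi>) (b \<and> c)"
  unfolding decided_def fAnd_def by blast

lemma decided_Not: "decided \<phi> b \<Longrightarrow> decided (fNot \<phi>) (\<not> b)"
  unfolding decided_def fNot_def using le_refl by blast

lemma decided_All: "(\<And>x. decided (\<Phi> x) (b x)) \<Longrightarrow> decided (fAll \<Phi>) (\<forall>x. b x)"
  unfolding decided_def fAll_def by blast

lemma decided_Imp: "decided \<phi> b \<Longrightarrow> decided \<psi> c \<Longrightarrow> decided (fImp \<phi> \<psi>) (b \<longrightarrow> c)"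
  unfolding fImp_def using decided_Not[OF decided_And[OF _ decided_Not], of \<phi> b \<psi> c] by simp

lemma decided_Iff:
  assumes "decided \<phi> b" "decided \<psi> c"
  shows "decided (fIff \<phi> \<psi>) (b \<longleftrightarrow> c)"
  using decided_And[OF decided_Imp[OF assms] decided_Imp[OF assms(2,1)]]
  unfolding fIff_def by (simp add: iff_conv_conj_imp)

lemma decided_Ex: "(\<And>x. decided (\<Phi> x) (b x)) \<Longrightarrow> decided (fEx \<Phi>) (\<exists>x. b x)"
  unfolding fEx_def using decided_Not[OF decided_All[OF decided_Not], of \<Phi> b] by simp

lemma decided_ExI: "decided (\<Phi> x) True \<Longrightarrow> decided (fEx \<Phi>) True"
  unfolding decided_def fEx_iff using le_refl by blast

text \<open>Upward only: a ground-model witness survives, whereas the lack of one says nothing about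
  new sets.\<close>

lemma decided_ExSetI: "N \<subseteq> UNIV \<times> P \<Longrightarrow> decided (\<Psi> N) True \<Longrightarrow> decided (fExSet \<Psi>) True"
  unfolding decided_def fExSet_iff using le_refl by blast

lemma decided_check: "decided (fMem x (check X)) (x \<in> X)"
  unfolding decided_def fMem_def check_def mem_Times_iff fst_conv snd_conv by (meson le_refl)

lemmas decided_intros = decided_And decided_All decided_Imp decided_Iff decided_Ex
  decided_Not decided_Ground decided_check

lemma decided_club: "decided (f_club (check C)) (club C)"
  unfolding f_club_def club_def Bex_def by (intro decided_intros)

lemma decided_finite:
  assumes "finite F"
  shows "decided (f_finite (check F)) True"
proof -
  obtain n :: nat and g where g: "F = g ` {i. i < n}"
    using assms finite_imp_nat_seg_image_inj_on by metis
  define f where "f = {(k, x). x = g k}"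
  have "(\<forall>k x y. (k, x) \<in> f \<and> (k, y) \<in> f \<longrightarrow> x = y) \<and>
      (\<forall>x. x \<in> F \<longleftrightarrow> (\<exists>k. k < n \<and> (k, x) \<in> f)) \<longleftrightarrow> True"
    unfolding f_def using g by auto
  moreover have "decided (fAnd (f_function (check f))
      (\<^bold>\<forall>x. fIff (fMem x (check F)) (\<^bold>\<exists>k. fAnd (fGround (k < n)) (fMem (k, x) (check f)))))
     ((\<forall>k x y. (k, x) \<in> f \<and> (k, y) \<in> f \<longrightarrow> x = y) \<and>
      (\<forall>x. x \<in> F \<longleftrightarrow> (\<exists>k. k < n \<and> (k, x) \<in> f)))"
    unfolding f_function_def by (intro decided_intros)
  ultimately show ?thesis
    unfolding f_finite_def by (intro decided_ExI[of _ n] decided_ExSetI[OF check_subset, of _ f]) simp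
qed

lemma decided_hat:
  assumes "\<alpha> \<in> hat a \<beta>"
  shows "decided (f_hat a \<beta> \<alpha>) True"
proof -
  obtain F where F: "\<alpha> \<le> \<beta>" "finite F" "F \<subseteq> {..<\<alpha>}" "a \<alpha> - a \<beta> \<subseteq> (\<Union>\<gamma>\<in>F. a \<gamma>)"
    using assms unfolding hat_def by blast
  \<comment> \<open>The leading \<open>True\<close> is the value of the finiteness clause, so that
    \<open>B\<close> matches the sentence clause by clause under
    \<open>decided_intros\<close>.\<close>
  define B where "B \<longleftrightarrow> True \<and> (\<forall>\<gamma>. \<gamma> \<in> F \<longrightarrow> \<gamma> < \<alpha>) \<and>
    (\<forall>k. k \<in> a \<alpha> \<and> \<not> k \<in> a \<beta> \<longrightarrow> (\<exists>\<gamma>. \<gamma> \<in> F \<and> k \<in> a \<gamma>))"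
  have B: "B = True"
    using F unfolding B_def by blast
  have "decided (fAnd (f_finite (check F)) (fAnd (\<^bold>\<forall>\<gamma>. fImp (fMem \<gamma> (check F)) (fGround (\<gamma> < \<alpha>)))
      (\<^bold>\<forall>k. fImp (fAnd (fGround (k \<in> a \<alpha>)) (fNot (fGround (k \<in> a \<beta>))))
        (\<^bold>\<exists>\<gamma>. fAnd (fMem \<gamma> (check F)) (fGround (k \<in> a \<gamma>)))))) B"
    unfolding B_def by (intro decided_intros decided_finite F(2))
  then have "decided (\<^bold>\<exists>\<^sub>s F. fAnd (f_finite F) (fAnd (\<^bold>\<forall>\<gamma>. fImp (fMem \<gamma> F) (fGround (\<gamma> < \<alpha>)))
      (\<^bold>\<forall>k. fImp (fAnd (fGround (k \<in> a \<alpha>)) (fNot (fGround (k \<in> a \<beta>))))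
        (\<^bold>\<exists>\<gamma>. fAnd (fMem \<gamma> F) (fGround (k \<in> a \<gamma>)))))) True"
    unfolding B by (rule decided_ExSetI[OF check_subset])
  then have "decided (f_hat a \<beta> \<alpha>) (\<alpha> \<le> \<beta> \<and> True)"
    unfolding f_hat_def by (intro decided_And decided_Ground)
  then show ?thesis
    using F(1) by simp
qed

text \<open>The check name of a ground-model club is forced to be club, so some condition below
  \<open>q\<close> forces an element of that club into \<open>S\<close>.\<close>

lemma f_stationary_trace:
  assumes "q \<in> P" "f_stationary S q"
  shows "stationary {\<gamma>. \<exists>r\<in>P. le r q \<and> fMem \<gamma> S r}"
  unfolding stationary_def
proof (intro allI impI)
  fix C
  assume "club C"
  then have "f_club (check C) q"
    using decided_club[of C] assms(1) unfolding decided_def by blast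
  then obtain r where r: "r \<in> P" "le r q" "(\<^bold>\<exists>\<alpha>. fAnd (fMem \<alpha> (check C)) (fMem \<alpha> S)) r"
    using assms check_subset[of C] le_refl[of q]
    unfolding f_stationary_def fAllSet_def fImp_iff by blast
  then obtain \<alpha> r' where r': "r' \<in> P" "le r' r" "fMem \<alpha> (check C) r'" "fMem \<alpha> S r'"
    using le_refl[of r] unfolding fEx_iff fAnd_def by blast
  have "\<alpha> \<in> C"
    using r'(1,3) decided_check[of \<alpha> C] unfolding decided_def by blast
  then show "\<exists>\<alpha>\<in>C. \<alpha> \<in> {\<gamma>. \<exists>r\<in>P. le r q \<and> fMem \<gamma> S r}"
    using r' r(2) le_trans by blast
qed

text \<open>Suppose \<open>f\<close> names a map of \<omega> onto \<open>\<omega>\<^sub>1\<close>.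
  Choosing a condition \<open>R \<xi>\<close> and an argument \<open>N \<xi>\<close> for each value
  \<xi>, two values share the argument and the centre; a common strengthening then gives
  \<open>f\<close> two values at one argument.\<close>

lemma sigma_centered_forces_omega1:
  fixes st :: "'p \<Rightarrow> 'c::countable"
  assumes centered: "\<And>p q. p \<in> P \<Longrightarrow> q \<in> P \<Longrightarrow> st p = st q \<Longrightarrow> \<exists>r\<in>P. le r p \<and> le r q"
  shows "f_omega1 p"
  unfolding f_omega1_def fNot_def
proof (intro ballI impI notI)
  fix q
  assume "q \<in> P" and "(\<^bold>\<exists>\<^sub>s f. fAnd (f_function f) (\<^bold>\<forall>\<xi>::omega1. \<^bold>\<exists>n. fMem (n, \<xi>) f)) q"
  then obtain f r where r: "r \<in> P" "f_function f r" "\<And>\<xi>::omega1. (\<^bold>\<exists>n. fMem (n, \<xi>) f) r"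
    unfolding fExSet_iff fAnd_def fAll_def using le_refl by blast
  have "\<exists>n. \<exists>r'\<in>P. le r' r \<and> fMem (n, \<xi>) f r'" for \<xi> :: omega1
    using r(1) r(3)[of \<xi>] le_refl unfolding fEx_iff by blast
  then obtain N R where NR: "\<And>\<xi>::omega1. R \<xi> \<in> P" "\<And>\<xi>. le (R \<xi>) r" "\<And>\<xi>. fMem (N \<xi>, \<xi>) f (R \<xi>)"
    by metis
  have "\<not> inj (\<lambda>\<xi>. (N \<xi>, st (R \<xi>)))"
    using uncountable_omega1 countable_image_inj_on[of "\<lambda>\<xi>. (N \<xi>, st (R \<xi>))" UNIV] by auto
  then obtain \<xi> \<eta> where \<xi>\<eta>: "\<xi> \<noteq> \<eta>" "N \<xi> = N \<eta>" "st (R \<xi>) = st (R \<eta>)"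
    unfolding inj_def by blast
  then obtain r' where r': "r' \<in> P" "le r' (R \<xi>)" "le r' (R \<eta>)"
    using centered NR(1) by meson
  have "fMem (N \<xi>, \<xi>) f r'" "fMem (N \<xi>, \<eta>) f r'"
    using r'(2,3) NR(3)[of \<xi>] NR(3)[of \<eta>] \<xi>\<eta>(2) fMem_mono by simp_all
  moreover have "le r' r"
    using r'(2) NR(2) le_trans by blast
  ultimately have "\<exists>q\<in>P. fGround (\<xi> = \<eta>) q"
    using r(2) r'(1) unfolding f_function_def fAll_def fImp_iff fAnd_def by meson
  then show False
    using \<xi>\<eta>(1) unfolding fGround_def by blast
qed

end


section \<open>Laver forcing with an ultrafilter\<close>

locale laver =
  fixes D :: "nat filter"
  assumes free: "free_ultrafilter D"
begin

sublocale forcing_preorder "laver_forcing D" "(\<subseteq>)"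
  by unfold_locales auto

lemma D_or: "eventually Q D \<or> eventually (\<lambda>n. \<not> Q n) D"
  using free unfolding free_ultrafilter_def by blast

lemma D_happens: "eventually Q D \<Longrightarrow> \<exists>n. Q n"
  using free eventually_happens unfolding free_ultrafilter_def by blast

lemma D_two:
  assumes "eventually (\<lambda>j. j \<in> X) D"
  shows "\<exists>i\<in>X. \<exists>j\<in>X. i \<noteq> j"
proof -
  obtain i where i: "i \<in> X"
    using D_happens[OF assms] by blast
  have "eventually (\<lambda>j. j \<noteq> i) D"
    using free unfolding free_ultrafilter_def le_filter_def by (simp add: eventually_cofinite)
  then have "eventually (\<lambda>j. j \<in> X \<and> j \<noteq> i) D"
    using assms by (simp add: eventually_conj)
  with i show ?thesis
    using D_happens by blast
qed

text \<open>Membership in \<open>laver_forcing D\<close> with the stem made a parameter.\<close>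

definition cond :: "nat list set \<Rightarrow> nat list \<Rightarrow> bool" where
  "cond T s \<longleftrightarrow> (\<forall>t\<in>T. \<forall>s. prefix s t \<longrightarrow> s \<in> T) \<and> is_stem T s \<and>
     (\<forall>t\<in>T. prefix s t \<longrightarrow> eventually (\<lambda>j. j \<in> succs T t) D)"

lemma laver_forcing_iff: "T \<in> laver_forcing D \<longleftrightarrow> (\<exists>s. cond T s)"
  unfolding laver_forcing_def cond_def by blast

lemma cond_in_laver_forcing: "cond T s \<Longrightarrow> T \<in> laver_forcing D"
  unfolding laver_forcing_iff by blast

lemma cond_stem_in: "cond T s \<Longrightarrow> s \<in> T"
  unfolding cond_def is_stem_def branching_def by blast

lemma cond_prefix: "cond T s \<Longrightarrow> t \<in> T \<Longrightarrow> prefix u t \<Longrightarrow> u \<in> T"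
  unfolding cond_def by blast

lemma cond_succs: "cond T s \<Longrightarrow> t \<in> T \<Longrightarrow> prefix s t \<Longrightarrow> eventually (\<lambda>j. t @ [j] \<in> T) D"
  unfolding cond_def succs_def by auto

text \<open>A node splitting off from the stem would make a proper initial segment of the stem
  branching.\<close>

lemma cond_comparable:
  assumes "cond T s" "t \<in> T"
  shows "prefix s t \<or> prefix t s"
proof (rule ccontr)
  assume "\<not> ?thesis"
  then have "s \<parallel> t"
    by blast
  then obtain u b bs c cs where u: "b \<noteq> c" "s = u @ b # bs" "t = u @ c # cs"
    using parallel_decomp by blast
  have "u @ [b] \<in> T" "u @ [c] \<in> T" "u \<in> T"
    using cond_prefix[OF assms(1) cond_stem_in[OF assms(1)]] cond_prefix[OF assms] u(2,3)
    by (auto simp: prefix_def)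
  then have "branching T u"
    using u(1) unfolding branching_def succs_def by blast
  moreover have "strict_prefix u s"
    using u(2) by (simp add: strict_prefix_def)
  ultimately show False
    using assms(1) unfolding cond_def is_stem_def by blast
qed

text \<open>The source of all conditions constructed below: a property inherited by
  \<open>D\<close>-many successors spans a tree with stem \<open>s\<close>.\<close>

lemma cond_exists:
  assumes "G s" and G: "\<And>t. prefix s t \<Longrightarrow> G t \<Longrightarrow> eventually (\<lambda>j. G (t @ [j])) D"
  shows "\<exists>T. cond T s \<and> (\<forall>t\<in>T. prefix t s \<or> prefix s t \<and> G t)"
proof -
  \<comment> \<open>Demanding \<open>G\<close> at all intermediate nodes closes \<open>T\<close>
    under initial segments; nodes properly below \<open>s\<close> are exempt.\<close>
  define T where
    "T = {t. (prefix t s \<or> prefix s t) \<and> (\<forall>u. prefix s u \<longrightarrow> prefix u t \<longrightarrow> G u)}"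
  have closed: "u \<in> T" if "t \<in> T" "prefix u t" for t u
    using that unfolding T_def by (auto dest: prefix_same_cases intro: prefix_order.trans)
  have succs: "eventually (\<lambda>j. j \<in> succs T t) D" if t: "t \<in> T" "prefix s t" for t
  proof -
    have "eventually (\<lambda>j. G (t @ [j])) D"
      using t G unfolding T_def by blast
    then show ?thesis
      by (rule eventually_mono) (use t in \<open>auto simp: T_def succs_def\<close>)
  qed
  have "s \<in> T"
    using \<open>G s\<close> unfolding T_def by (auto dest: prefix_order.antisym)
  then have "branching T s"
    using D_two[OF succs[of s]] unfolding branching_def by blast
  moreover have "\<not> branching T t" if t: "strict_prefix t s" for t
  proof
    assume "branching T t"
    then obtain i j where ij: "i \<noteq> j" "t @ [i] \<in> T" "t @ [j] \<in> T"
      unfolding branching_def succs_def by blast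
    obtain c cs where s: "s = t @ c # cs"
      using t by (auto elim: strict_prefixE')
    \<comment> \<open>Below the stem the only successor is the next entry of
      \<open>s\<close>.\<close>
    have "k = c" if "t @ [k] \<in> T" for k
      using that unfolding T_def s by (auto simp: prefix_def)
    with ij show False
      by blast
  qed
  ultimately have "cond T s"
    using closed succs unfolding cond_def is_stem_def by blast
  moreover have "prefix t s \<or> prefix s t \<and> G t" if "t \<in> T" for t
    using that unfolding T_def by blast
  ultimately show ?thesis
    by blast
qed

section \<open>Compatibility, restriction and stems of stronger conditions\<close>

lemma cond_Int:
  assumes "cond T s" "cond T' s"
  shows "\<exists>R. cond R s \<and> R \<subseteq> T \<and> R \<subseteq> T'"
proof -
  have s: "s \<in> T" "s \<in> T'"
    using assms cond_stem_in by blast+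
  have "eventually (\<lambda>j. t @ [j] \<in> T \<and> t @ [j] \<in> T') D" if "prefix s t" "t \<in> T \<and> t \<in> T'" for t
    using that cond_succs[OF assms(1)] cond_succs[OF assms(2)] by (simp add: eventually_conj)
  then obtain R where "cond R s" "\<And>t. t \<in> R \<Longrightarrow> prefix t s \<or> t \<in> T \<and> t \<in> T'"
    using cond_exists[of "\<lambda>t. t \<in> T \<and> t \<in> T'" s] s by blast
  then show ?thesis
    using s cond_prefix[OF assms(1)] cond_prefix[OF assms(2)] by blast
qed

lemma cond_restrict:
  assumes "cond T s" "t \<in> T" "prefix s t"
  shows "\<exists>R. cond R t \<and> R \<subseteq> T"
proof -
  have "eventually (\<lambda>j. u @ [j] \<in> T) D" if "prefix t u" "u \<in> T" for u
    using that assms cond_succs prefix_order.trans by blast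
  then obtain R where "cond R t" "\<And>u. u \<in> R \<Longrightarrow> prefix u t \<or> u \<in> T"
    using cond_exists[of "\<lambda>u. u \<in> T" t] assms(2) by blast
  then show ?thesis
    using cond_prefix[OF assms(1,2)] by blast
qed

text \<open>A node that branches in \<open>R\<close> branches in \<open>T\<close>, and no proper
  initial segment of the stem of \<open>T\<close> does.\<close>

lemma cond_stem_mono:
  assumes "cond T s" "cond R t" "R \<subseteq> T"
  shows "prefix s t"
proof (rule ccontr)
  assume "\<not> prefix s t"
  moreover have "t \<in> T"
    using assms cond_stem_in by blast
  ultimately have "strict_prefix t s"
    using cond_comparable[OF assms(1)] by (auto simp: strict_prefix_def)
  moreover have "branching T t"
    using assms(2,3) unfolding cond_def is_stem_def branching_def succs_def by blast
  ultimately show False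
    using assms(1) unfolding cond_def is_stem_def by blast
qed

text \<open>Stems are finite sequences of numbers, hence countably many, and conditions with equal
  stems are compatible. \<open>SOME\<close> assigns each condition a stem.\<close>

lemma laver_forces_omega1: "f_omega1 p"
proof (rule sigma_centered_forces_omega1)
  fix p q
  assume "p \<in> laver_forcing D" "q \<in> laver_forcing D"
    and eq: "(SOME s. cond p s) = (SOME s. cond q s)"
  then have "cond p (SOME s. cond p s)" "cond q (SOME s. cond p s)"
    unfolding laver_forcing_iff by (metis someI_ex)+
  from cond_Int[OF this] obtain r where "cond r (SOME s. cond p s)" "r \<subseteq> p" "r \<subseteq> q"
    by blast
  then show "\<exists>r\<in>laver_forcing D. r \<subseteq> p \<and> r \<subseteq> q"
    using cond_in_laver_forcing by blast
qed

text \<open>A ground-model approximation to the named set. By \<open>cond_Int\<close>, any condition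
  with stem \<open>t\<close> can be strengthened to force a given member of the trace into
  \<open>S\<close>.\<close>

definition stem_trace :: "('x, nat list set) name \<Rightarrow> nat list \<Rightarrow> 'x set" where
  "stem_trace S t = {x. \<exists>T. cond T t \<and> fMem x S T}"

lemma stem_trace_succs:
  assumes "x \<in> stem_trace S t"
  shows "eventually (\<lambda>j. x \<in> stem_trace S (t @ [j])) D"
proof -
  obtain T where T: "cond T t" "fMem x S T"
    using assms unfolding stem_trace_def by blast
  have "eventually (\<lambda>j. t @ [j] \<in> T) D"
    using T(1) cond_stem_in cond_succs by blast
  then show ?thesis
  proof (rule eventually_mono)
    fix j
    assume "t @ [j] \<in> T"
    then obtain R where "cond R (t @ [j])" "R \<subseteq> T"
      using cond_restrict[OF T(1), of "t @ [j]"] by auto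
    then show "x \<in> stem_trace S (t @ [j])"
      using fMem_mono[OF T(2)] unfolding stem_trace_def by blast
  qed
qed

text \<open>Uncovered points, one for each successor of \<open>t\<close>, would have a \<open>D\<close>-limit. The limit lies in
  some \<open>hat a \<gamma>\<close> of the cover at \<open>t\<close>, so \<open>hat a \<gamma>\<close> contains \<open>D\<close>-many of these points, although
  \<open>\<gamma>\<close> is still in the trace at \<open>D\<close>-many successors.\<close>

lemma cover_succs:
  assumes lim: "\<And>f. \<exists>x. \<forall>\<gamma>. eventually (\<lambda>j. f j \<in> hat a \<gamma> \<longleftrightarrow> x \<in> hat a \<gamma>) D"
    and cov: "cover a (stem_trace S t \<union> F)"
  shows "eventually (\<lambda>j. cover a (stem_trace S (t @ [j]) \<union> F)) D"
proof (rule ccontr)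
  assume "\<not> ?thesis"
  then have bad: "eventually (\<lambda>j. \<not> cover a (stem_trace S (t @ [j]) \<union> F)) D"
    using D_or by blast
  \<comment> \<open>At a successor that is covered the implication is vacuous and the value of
    \<open>f\<close> arbitrary.\<close>
  have "\<exists>x. \<not> cover a (stem_trace S (t @ [j]) \<union> F) \<longrightarrow>
      (\<forall>\<gamma>\<in>stem_trace S (t @ [j]) \<union> F. x \<notin> hat a \<gamma>)" for j
    unfolding cover_def by blast
  then obtain f where f: "\<And>j. \<not> cover a (stem_trace S (t @ [j]) \<union> F) \<Longrightarrow>
      \<forall>\<gamma>\<in>stem_trace S (t @ [j]) \<union> F. f j \<notin> hat a \<gamma>"
    by metis
  obtain x where x: "\<And>\<gamma>. eventually (\<lambda>j. f j \<in> hat a \<gamma> \<longleftrightarrow> x \<in> hat a \<gamma>) D"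
    using lim by blast
  obtain \<gamma> where \<gamma>: "\<gamma> \<in> stem_trace S t \<union> F" "x \<in> hat a \<gamma>"
    using cov unfolding cover_def by blast
  have "eventually (\<lambda>j. \<gamma> \<in> stem_trace S (t @ [j]) \<union> F) D"
  proof (cases "\<gamma> \<in> F")
    case False
    then have "eventually (\<lambda>j. \<gamma> \<in> stem_trace S (t @ [j])) D"
      using \<gamma>(1) by (intro stem_trace_succs) simp
    then show ?thesis
      by (rule eventually_mono) blast
  qed simp
  with bad x[of \<gamma>] have "eventually (\<lambda>j. False) D"
    by eventually_elim (use f \<gamma>(2) in blast)
  then show False
    using D_happens by blast
qed

text \<open>The points forced into \<open>S\<close> by conditions below \<open>q\<close> form a
  stationary set; it splits into countably many pieces according to the stem, one of which is
  stationary.\<close>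

lemma stationary_stem_trace:
  assumes "cond q s" "f_stationary S q"
  shows "\<exists>t\<in>q. prefix s t \<and> stationary (stem_trace S t)"
proof -
  define X where "X t = {\<gamma>. \<exists>r. cond r t \<and> r \<subseteq> q \<and> fMem \<gamma> S r}" for t
  have "{\<gamma>. \<exists>r\<in>laver_forcing D. r \<subseteq> q \<and> Q \<gamma> r} =
      (\<Union>t. {\<gamma>. \<exists>r. cond r t \<and> r \<subseteq> q \<and> Q \<gamma> r})" for Q :: "omega1 \<Rightarrow> nat list set \<Rightarrow> bool"
    by (rule set_eqI, simp add: Bex_def laver_forcing_iff) metis
  then have "{\<gamma>. \<exists>r\<in>laver_forcing D. r \<subseteq> q \<and> fMem \<gamma> S r} = (\<Union>t. X t)"
    unfolding X_def .
  moreover have "stationary {\<gamma>. \<exists>r\<in>laver_forcing D. r \<subseteq> q \<and> fMem \<gamma> S r}"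
    using f_stationary_trace[OF cond_in_laver_forcing[OF assms(1)] assms(2)] .
  ultimately obtain t where t: "stationary (X t)"
    using stationary_UN[of X] by auto
  \<comment> \<open>Only a member of \<open>X t\<close> is wanted: its witness \<open>r\<close>
    places \<open>t\<close> in \<open>q\<close> beyond \<open>s\<close>.\<close>
  then have "\<exists>\<gamma>\<in>{undefined<..}. \<gamma> \<in> X t"
    using club_greaterThan unfolding stationary_def by simp
  then obtain \<gamma> where "\<gamma> \<in> X t"
    by (elim bexE)
  then obtain r where r: "cond r t" "r \<subseteq> q"
    unfolding X_def by blast
  have "t \<in> q"
    using cond_stem_in[OF r(1)] r(2) by (rule subsetD[rotated])
  moreover have "prefix s t"
    using cond_stem_mono[OF assms(1) r] .
  moreover have "X t \<subseteq> stem_trace S t"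
    unfolding X_def stem_trace_def by blast
  then have "stationary (stem_trace S t)"
    using t unfolding stationary_def by (meson subsetD)
  ultimately show ?thesis
    by blast
qed

lemma laver_forces_ScP:
  assumes lim: "\<And>f. \<exists>x. \<forall>\<gamma>. eventually (\<lambda>j. f j \<in> hat a \<gamma> \<longleftrightarrow> x \<in> hat a \<gamma>) D"
    and "ScP a"
  shows "f_ScP a p"
proof -
  \<comment> \<open>By \<open>fImp_iff\<close> the covering clause of the ScP reduces to this
    density statement.\<close>
  have main: "\<exists>r\<in>laver_forcing D. r \<subseteq> q \<and>
      fExSet (\<lambda>F. fAnd (f_finite F)
        (\<^bold>\<forall>\<alpha>. fEx (\<lambda>\<gamma>. fAnd (fOr (fMem \<gamma> S) (fMem \<gamma> F)) (f_hat a \<gamma> \<alpha>)))) r"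
    if q: "q \<in> laver_forcing D" and stat: "f_stationary S q" for q S
  proof -
    obtain s where s: "cond q s"
      using q laver_forcing_iff by blast
    obtain t where t: "t \<in> q" "prefix s t" "stationary (stem_trace S t)"
      using stationary_stem_trace[OF s stat] by blast
    then obtain F where F: "finite F" "cover a (stem_trace S t \<union> F)"
      using \<open>ScP a\<close> unfolding ScP_def by blast
    \<comment> \<open>\<open>F\<close> is fixed at \<open>t\<close> and kept at all later nodes, so
      the single name \<open>check F\<close> serves throughout.\<close>
    define G where "G u \<longleftrightarrow> u \<in> q \<and> cover a (stem_trace S u \<union> F)" for u
    have "eventually (\<lambda>j. G (u @ [j])) D" if "prefix t u" "G u" for u
    proof -
      have "prefix s u"
        using t(2) that(1) by (rule prefix_order.trans)
      then have "eventually (\<lambda>j. u @ [j] \<in> q) D"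
        using that(2) cond_succs[OF s] unfolding G_def by simp
      moreover have "eventually (\<lambda>j. cover a (stem_trace S (u @ [j]) \<union> F)) D"
        using that(2) cover_succs[OF lim] unfolding G_def by simp
      ultimately show ?thesis
        unfolding G_def by (rule eventually_conj)
    qed
    moreover have "G t"
      using t(1) F(2) unfolding G_def by blast
    ultimately obtain T where T: "cond T t" "\<And>u. u \<in> T \<Longrightarrow> prefix u t \<or> prefix t u \<and> G u"
      using cond_exists[of G t] by blast
    have "T \<subseteq> q"
      using T(2) t(1) cond_prefix[OF s] unfolding G_def by blast
    \<comment> \<open>The stem \<open>u\<close> of \<open>q'\<close> satisfies \<open>G\<close>, so
      \<alpha> lies in the hat of some \<gamma> in \<open>F\<close> or in the trace at
      \<open>u\<close>. In the latter case a condition with the same stem forces \<gamma> into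
      \<open>S\<close>, and it is compatible with \<open>q'\<close>.\<close>
    have covered: "\<exists>\<gamma>. \<exists>r\<in>laver_forcing D. r \<subseteq> q' \<and>
        fAnd (fOr (fMem \<gamma> S) (fMem \<gamma> (check F))) (f_hat a \<gamma> \<alpha>) r"
      if q': "q' \<in> laver_forcing D" "q' \<subseteq> T" for q' \<alpha>
    proof -
      obtain u where u: "cond q' u"
        using q'(1) laver_forcing_iff by blast
      have "prefix t u"
        using cond_stem_mono[OF T(1) u q'(2)] .
      moreover have "u \<in> T"
        using u q'(2) cond_stem_in by blast
      ultimately have "G u"
        using T(2)[of u] \<open>G t\<close> prefix_order.antisym by blast
      then obtain \<gamma> where \<gamma>: "\<gamma> \<in> stem_trace S u \<union> F" "\<alpha> \<in> hat a \<gamma>"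
        unfolding G_def cover_def by blast
      obtain r where r: "r \<in> laver_forcing D" "r \<subseteq> q'" "fMem \<gamma> S r \<or> fMem \<gamma> (check F) r"
      proof (cases "\<gamma> \<in> F")
        case True
        then have "fMem \<gamma> (check F) q'"
          using decided_check[of \<gamma> F] q'(1) unfolding decided_def by blast
        with q'(1) show ?thesis
          using that by blast
      next
        case False
        then obtain T' where "cond T' u" "fMem \<gamma> S T'"
          using \<gamma>(1) unfolding stem_trace_def by blast
        with u show ?thesis
          using that cond_Int[of q' u T'] fMem_mono cond_in_laver_forcing by meson
      qed
      have "fOr (fMem \<gamma> S) (fMem \<gamma> (check F)) r"
        using r(3) by (rule fOr_fMemI)
      moreover have "f_hat a \<gamma> \<alpha> r"
        using decidedD[OF decided_hat[OF \<gamma>(2)] r(1)] .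
      ultimately have "fAnd (fOr (fMem \<gamma> S) (fMem \<gamma> (check F))) (f_hat a \<gamma> \<alpha>) r"
        unfolding fAnd_def ..
      with r(1,2) show ?thesis
        by (intro exI bexI conjI)
    qed
    have "fAnd (f_finite (check F))
        (\<^bold>\<forall>\<alpha>. fEx (\<lambda>\<gamma>. fAnd (fOr (fMem \<gamma> S) (fMem \<gamma> (check F))) (f_hat a \<gamma> \<alpha>))) r"
      if "r \<in> laver_forcing D" "r \<subseteq> T" for r
      unfolding fAnd_def[of "f_finite (check F)"] fAll_def fEx_iff
    proof (intro conjI allI ballI impI)
      show "f_finite (check F) r"
        using decidedD[OF decided_finite[OF F(1)] that(1)] .
    next
      fix \<alpha> q'
      assume "q' \<in> laver_forcing D" "q' \<subseteq> r"
      with that(2) show "\<exists>\<gamma>. \<exists>r\<in>laver_forcing D. r \<subseteq> q' \<and>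
          fAnd (fOr (fMem \<gamma> S) (fMem \<gamma> (check F))) (f_hat a \<gamma> \<alpha>) r"
        by (intro covered subset_trans[of q' r T])
    qed
    then have "fExSet (\<lambda>F. fAnd (f_finite F)
        (\<^bold>\<forall>\<alpha>. fEx (\<lambda>\<gamma>. fAnd (fOr (fMem \<gamma> S) (fMem \<gamma> F)) (f_hat a \<gamma> \<alpha>)))) T"
      by (rule fExSetI[OF check_subset])
    then show ?thesis
      using cond_in_laver_forcing[OF T(1)] \<open>T \<subseteq> q\<close> by blast
  qed
  show ?thesis
    unfolding f_ScP_def fAnd_def[of f_omega1] fAllSet_def fImp_iff
    using laver_forces_omega1 main by blast
qed

end

theorem theorem2p12:
  fixes a :: "omega1 \<Rightarrow> nat set"
  assumes "diamond"
    and "proper_seq a" and "coherent a" and "ScP a"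
  shows "\<exists>D. free_ultrafilter D \<and> preserves_ScP (laver_forcing D) (\<subseteq>) a"
proof -
  obtain D where D: "free_ultrafilter D"
    "\<And>f. \<exists>x. \<forall>\<gamma>. eventually (\<lambda>j. f j \<in> hat a \<gamma> \<longleftrightarrow> x \<in> hat a \<gamma>) D"
    using hat_compact_ultrafilter[OF assms] by blast
  interpret laver D
    by unfold_locales (rule D(1))
  have "preserves_ScP (laver_forcing D) (\<subseteq>) a"
    unfolding preserves_ScP_def forced_def using laver_forces_ScP[OF D(2) \<open>ScP a\<close>] by blast
  with D(1) show ?thesis
    by blast
qed

end
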